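(* Let $n\geq 1$ be an integer, let $S$ be a finite symmetric generating set of $\mathbb{Z}^n$ (i.e. $S=-S$) not containing the identity, and let $G=F(S,2^{\mathbb{Z}^n})$ be the Schreier graph, with respect to $S$, of the Bernoulli shift action of $\mathbb{Z}^n$ restricted to the free part $F(2^{\mathbb{Z}^n})$ of $2^{\mathbb{Z}^n}$. Then the continuous edge chromatic number and the edge chromatic number of $G$ satisfy $$\chi'_c(G)=\chi'(G)+1=|S|+1.$$
   Context: Bernoulli shift: $2^{\mathbb{Z}^n}=\{0,1\}^{\mathbb{Z}^n}$ has the product topology, and $\mathbb{Z}^n$ acts on it by $(g\cdot x)(h)=x(h+g)$. The free part is $F(2^{\mathbb{Z}^n})=\{x\in 2^{\mathbb{Z}^n}: g\cdot x\neq x \text{ for all } g\in\mathbb{Z}^n,\ g\neq \bar 0\}$, with the subspace topology; it is an invariant set. Schreier graph: $F(S,2^{\mathbb{Z}^n})$ is the (undirected, simple) graph with vertex set $F(2^{\mathbb{Z}^n})$ in which $x,y$ are joined by an edge iff $y=s\cdot x$ for some $s\in S$. A proper edge $\kappa$-coloring of a graph $G$ is a map $c:E(G)\to\kappa$ such that distinct edges sharing a vertex receive distinct values. $\chi'(G)$ is the least cardinality of a set $\kappa$ for which a proper edge $\kappa$-coloring of $G$ exists. For $G=F(S,2^{\mathbb{Z}^n})$, an edge coloring $c$ with values in a discrete set $\kappa$ is continuous if for each $s\in S$ the map $x\mapsto c(x,s\cdot x)$ is continuous on $F(2^{\mathbb{Z}^n})$. $\chi'_c(G)$ is the least cardinality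 of a (discrete) set $\kappa$ for which a continuous proper edge $\kappa$-coloring of $G$ exists. *)

theory Defs
  imports
    "HOL-Analysis.Analysis"
    "HOL-Computational_Algebra.Group_Closure"
    "HOL-Library.Extended_Nat"
begin

(* A simple undirected graph is a pair (V, E) of a vertex set and a set of
   two-element subsets of V. *)
type_synonym 'a sgraph = "'a set \<times> 'a set set"

definition proper_edge_coloring :: "'a sgraph \<Rightarrow> 'k set \<Rightarrow> ('a set \<Rightarrow> 'k) \<Rightarrow> bool" where
  "proper_edge_coloring G K c \<longleftrightarrow>
     c ` snd G \<subseteq> K \<and>
     (\<forall>e\<in>snd G. \<forall>f\<in>snd G. e \<noteq> f \<and> e \<inter> f \<noteq> {} \<longrightarrow> c e \<noteq> c f)"

(* Since whether colors from a set K suffice depends only on the cardinality of K,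
   it is enough to consider the color sets {..<k}. The value is \<infinity> (the infimum of
   the empty set) if no finite set of colors suffices; infinite cardinals are not
   distinguished from each other. *)
definition edge_chromatic_number :: "'a sgraph \<Rightarrow> enat" where
  "edge_chromatic_number G =
     (INF k\<in>{k. \<exists>c. proper_edge_coloring G {..<k::nat} c}. enat k)"

(* The space 2^(Z^n) is the type int ^ 'n \<Rightarrow> bool. Its type class topology is the
   product topology, with bool discrete. *)
definition shift :: "int ^ 'n \<Rightarrow> (int ^ 'n \<Rightarrow> bool) \<Rightarrow> (int ^ 'n \<Rightarrow> bool)" where
  "shift g x = (\<lambda>h. x (h + g))"

definition free_part :: "(int ^ 'n \<Rightarrow> bool) set" where
  "free_part = {x. \<forall>g. g \<noteq> 0 \<longrightarrow> shift g x \<noteq> x}"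

definition schreier_graph :: "(int ^ 'n) set \<Rightarrow> (int ^ 'n \<Rightarrow> bool) sgraph" where
  "schreier_graph S =
     (free_part,
      {{x, y} | x y. x \<in> free_part \<and> y \<in> free_part \<and> x \<noteq> y \<and> (\<exists>s\<in>S. y = shift s x)})"

definition continuous_edge_coloring ::
    "(int ^ 'n) set \<Rightarrow> 'k set \<Rightarrow> ((int ^ 'n \<Rightarrow> bool) set \<Rightarrow> 'k) \<Rightarrow> bool" where
  "continuous_edge_coloring S K c \<longleftrightarrow>
     (\<forall>s\<in>S. continuous_map (top_of_set free_part) (discrete_topology K)
               (\<lambda>x. c {x, shift s x}))"

(* The continuous edge chromatic number of the graph schreier_graph S; it takes S
   because continuity of a coloring is defined via the generators. *)
definition continuous_edge_chromatic_number :: "(int ^ 'n) set \<Rightarrow> enat" where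
  "continuous_edge_chromatic_number S =
     (INF k\<in>{k. \<exists>c. proper_edge_coloring (schreier_graph S) {..<k::nat} c \<and>
                    continuous_edge_coloring S {..<k} c}. enat k)"

end

theory Submission
  imports Defs "HOL-Library.Z2"
begin

text \<open>
  Write \<open>S = P \<union> -P\<close>. Colouring the edges along each line in a direction \<open>s \<in> P\<close> alternately with
  two colours private to \<open>s\<close> uses \<open>|S|\<close> colours, the degree of the graph. A continuous colouring
  spends one further colour, shared by all directions, on a clopen matching which meets every
  line in every direction \<open>s \<in> P\<close> at bounded gaps; starting afresh after each edge of the matching
  makes the alternating colouring along the lines continuous. The matching is chosen one direction
  at a time, as a maximal clopen set of edges that is sparse along all lines: by sparseness the
  edges already chosen block few edges of any long segment, and by maximality
  and the pigeonhole principle a long segment without a chosen edge cannot exist.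

  Conversely, each colour class of a continuous colouring with \<open>|S|\<close> colours is a continuous
  perfect matching. There are points of period \<open>3 ^ K\<close> in all coordinate directions, combined from
  one-dimensional Toeplitz sequences, that are aperiodic uniformly in \<open>K\<close>, so that their limits form
  a compact subset of the free part. By compactness the matching is given there by a finite
  window, and hence carries over to a torus with \<open>3 ^ (K n)\<close> vertices, an odd number.
\<close>

section \<open>Continuity on the free part\<close>

lemma shift_shift: "shift g (shift h x) = shift (g + h) x"
  by (simp add: shift_def ac_simps)

lemma shift_0 [simp]: "shift 0 x = x"
  by (simp add: shift_def)

lemma shift_in_free_part [simp]: "shift g x \<in> free_part \<longleftrightarrow> x \<in> free_part"
proof -
  have *: "shift g x \<in> free_part" if "x \<in> free_part" for g x
    unfolding free_part_def
  proof (rule CollectI, intro allI impI notI)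
    fix h assume "h \<noteq> 0" and eq: "shift h (shift g x) = shift g x"
    have "shift (-g) (shift h (shift g x)) = shift (-g) (shift g x)"
      using eq by simp
    then have "shift h x = x"
      by (simp add: shift_shift)
    with that \<open>h \<noteq> 0\<close> show False
      by (simp add: free_part_def)
  qed
  from *[of x g] *[of "shift g x" "-g"] show ?thesis
    by (auto simp: shift_shift)
qed

lemma shift_eq_iff:
  assumes "x \<in> free_part"
  shows "shift g x = shift h x \<longleftrightarrow> g = h"
proof
  assume "shift g x = shift h x"
  then have "shift (g - h) x = x"
    by (metis shift_shift shift_0 add.commute diff_add_cancel left_minus uminus_add_conv_diff)
  with assms show "g = h"
    by (force simp: free_part_def)
qed simp

lemma shift_eq_self_iff: "x \<in> free_part \<Longrightarrow> shift g x = x \<longleftrightarrow> g = 0"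
  using shift_eq_iff[of x g 0] by simp

lemma shift_eq_shift_iff: "shift g x = shift h y \<longleftrightarrow> y = shift (g - h) x"
proof
  assume "shift g x = shift h y"
  then have "shift (-h) (shift g x) = shift (-h) (shift h y)"
    by simp
  then show "y = shift (g - h) x"
    by (simp add: shift_shift)
qed (simp add: shift_shift)

lemma free_part_nonempty: "(\<lambda>h. h = 0) \<in> (free_part :: (int ^ 'n \<Rightarrow> bool) set)"
  unfolding free_part_def
proof (rule CollectI, intro allI impI notI)
  fix g :: "int ^ 'n" assume "g \<noteq> 0" "shift g (\<lambda>h. h = 0) = (\<lambda>h. h = 0)"
  from this(1) fun_cong[OF this(2), of 0] show False
    by (simp add: shift_def)
qed

text \<open>Continuity into a discrete space, expressed by finite windows. The window may vary with
  the point, since the free part is not compact, and values outside the free part are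
  ignored.\<close>

definition finitary :: "((int ^ 'n \<Rightarrow> bool) \<Rightarrow> 'b) \<Rightarrow> bool" where
  "finitary f \<longleftrightarrow> (\<forall>x\<in>free_part. \<exists>H. finite H \<and>
     (\<forall>y\<in>free_part. (\<forall>h\<in>H. y h = x h) \<longrightarrow> f y = f x))"

lemma finitaryE:
  fixes f :: "(int ^ 'n \<Rightarrow> bool) \<Rightarrow> 'b"
  assumes "finitary f" "x \<in> free_part"
  obtains H where "finite H" "\<forall>y\<in>free_part. (\<forall>h\<in>H. y h = x h) \<longrightarrow> f y = f x"
proof -
  from bspec[OF assms(1)[unfolded finitary_def] assms(2)] obtain H
    where H: "finite H \<and> (\<forall>y\<in>free_part. (\<forall>h\<in>H. y h = x h) \<longrightarrow> f y = f x)"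
    by (rule exE)
  show ?thesis
    by (rule that[OF conjunct1[OF H] conjunct2[OF H]])
qed

lemma finitary_const [simp]: "finitary (\<lambda>_. c)"
  unfolding finitary_def by (intro ballI exI[of _ "{}"]) simp

lemma finitary_depends:
  fixes f :: "(int ^ 'n \<Rightarrow> bool) \<Rightarrow> 'b"
  assumes "finitary f"
    and "\<And>x y. x \<in> free_part \<Longrightarrow> y \<in> free_part \<Longrightarrow> f x = f y \<Longrightarrow> g x = g y"
  shows "finitary g"
  unfolding finitary_def
proof
  fix x :: "int ^ 'n \<Rightarrow> bool" assume x: "x \<in> free_part"
  obtain H where "finite H" and H: "\<forall>y\<in>free_part. (\<forall>h\<in>H. y h = x h) \<longrightarrow> f y = f x"
    by (rule finitaryE[OF assms(1) x])
  have "g y = g x" if "y \<in> free_part" "\<forall>h\<in>H. y h = x h" for y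
    by (rule assms(2)[OF that(1) x]) (simp add: H that)
  with \<open>finite H\<close> show "\<exists>H. finite H \<and> (\<forall>y\<in>free_part. (\<forall>h\<in>H. y h = x h) \<longrightarrow> g y = g x)"
    by (intro exI[of _ H]) simp
qed

lemma finitary_compose: "finitary f \<Longrightarrow> finitary (\<lambda>x. k (f x))"
  by (erule finitary_depends) simp

lemma finitary_compose2:
  fixes f :: "(int ^ 'n \<Rightarrow> bool) \<Rightarrow> 'b"
  assumes "finitary f" "finitary g"
  shows "finitary (\<lambda>x. k (f x) (g x))"
  unfolding finitary_def
proof
  fix x :: "int ^ 'n \<Rightarrow> bool" assume x: "x \<in> free_part"
  obtain H where H: "finite H" "\<forall>y\<in>free_part. (\<forall>h\<in>H. y h = x h) \<longrightarrow> f y = f x"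
    by (rule finitaryE[OF assms(1) x])
  obtain H' where H': "finite H'" "\<forall>y\<in>free_part. (\<forall>h\<in>H'. y h = x h) \<longrightarrow> g y = g x"
    by (rule finitaryE[OF assms(2) x])
  have "k (f y) (g y) = k (f x) (g x)"
    if "y \<in> free_part" "\<forall>h\<in>H \<union> H'. y h = x h" for y
  proof -
    have "f y = f x" "g y = g x"
      using that by (blast intro!: H(2)[rule_format], blast intro!: H'(2)[rule_format])
    then show ?thesis
      by simp
  qed
  then show "\<exists>H. finite H \<and> (\<forall>y\<in>free_part. (\<forall>h\<in>H. y h = x h) \<longrightarrow> k (f y) (g y) = k (f x) (g x))"
    using H(1) H'(1) by (intro exI[of _ "H \<union> H'"]) simp
qed

lemma finitary_ball:
  assumes "finite I" "\<And>i. i \<in> I \<Longrightarrow> finitary (P i)"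
  shows "finitary (\<lambda>x. \<forall>i\<in>I. P i x)"
  using assms
proof (induction I rule: finite_induct)
  case (insert i I)
  then have "finitary (\<lambda>x. P i x \<and> (\<forall>i\<in>I. P i x))"
    by (intro finitary_compose2[where k = "(\<and>)"]) simp_all
  then show ?case
    by simp
qed simp

lemma finitary_shift:
  fixes f :: "(int ^ 'n \<Rightarrow> bool) \<Rightarrow> 'b"
  assumes "finitary f"
  shows "finitary (\<lambda>x. f (shift g x))"
  unfolding finitary_def
proof
  fix x :: "int ^ 'n \<Rightarrow> bool" assume x: "x \<in> free_part"
  then have "shift g x \<in> free_part"
    by simp
  then obtain H where H: "finite H"
      "\<forall>y\<in>free_part. (\<forall>h\<in>H. y h = shift g x h) \<longrightarrow> f y = f (shift g x)"
    by (rule finitaryE[OF assms])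
  have "f (shift g y) = f (shift g x)"
    if "y \<in> free_part" "\<forall>h\<in>(\<lambda>h. h + g) ` H. y h = x h" for y
  proof -
    have "\<forall>h\<in>H. shift g y h = shift g x h"
      using that(2) by (simp add: shift_def)
    with that(1) H(2) show ?thesis
      by simp
  qed
  with H(1) show "\<exists>H. finite H \<and> (\<forall>y\<in>free_part. (\<forall>h\<in>H. y h = x h) \<longrightarrow> f (shift g y) = f (shift g x))"
    by (intro exI[of _ "(\<lambda>h. h + g) ` H"]) simp
qed

section \<open>Cylinders and the product topology\<close>

lemma open_cylinder:
  assumes "finite H"
  shows "open {y :: 'a \<Rightarrow> bool. \<forall>h\<in>H. y h = x h}"
proof -
  have "open {y :: 'a \<Rightarrow> bool. y h \<in> {x h}}" for h
  proof -
    have "open ((\<lambda>y. y h) -` {x h} :: ('a \<Rightarrow> bool) set)"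
      by (intro open_vimage continuous_on_product_coordinates open_discrete)
    then show ?thesis
      by (simp add: vimage_def)
  qed
  then have "open (\<Inter>h\<in>H. {y :: 'a \<Rightarrow> bool. y h \<in> {x h}})"
    using assms by (intro open_INT) auto
  also have "(\<Inter>h\<in>H. {y :: 'a \<Rightarrow> bool. y h \<in> {x h}}) = {y. \<forall>h\<in>H. y h = x h}"
    by auto
  finally show ?thesis .
qed

lemma open_contains_cylinder:
  fixes U :: "('a \<Rightarrow> bool) set"
  assumes "open U" "x \<in> U"
  obtains H where "finite H" "{y. \<forall>h\<in>H. y h = x h} \<subseteq> U"
proof -
  have "openin (product_topology (\<lambda>i. euclidean) UNIV) U"
    using assms by (simp add: euclidean_product_topology)
  from product_topology_open_contains_basis[OF this assms(2)]
  obtain X where X: "x \<in> PiE UNIV X" "finite {i. X i \<noteq> UNIV}" "PiE UNIV X \<subseteq> U"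
    by auto
  show ?thesis
  proof
    have "y i \<in> X i" if "\<forall>h\<in>{i. X i \<noteq> UNIV}. y h = x h" for y i
      using that X(1) by (cases "X i = UNIV") auto
    then show "{y. \<forall>h\<in>{i. X i \<noteq> UNIV}. y h = x h} \<subseteq> U"
      using X(3) by auto
  qed (use X in auto)
qed

text \<open>Fibres of a continuous map to a discrete space are relatively open, so each contains the
  free part of a cylinder around each of its points. Conversely, such cylinders make every preimage
  open.\<close>

lemma continuous_map_discrete_iff_finitary:
  fixes f :: "(int ^ 'n \<Rightarrow> bool) \<Rightarrow> 'b"
  shows "continuous_map (top_of_set free_part) (discrete_topology K) f \<longleftrightarrow>
           f ` free_part \<subseteq> K \<and> finitary f"
proof
  assume f: "continuous_map (top_of_set free_part) (discrete_topology K) f"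
  then have K: "f ` free_part \<subseteq> K"
    by (auto simp: continuous_map_def Pi_iff)
  moreover have "finitary f"
    unfolding finitary_def
  proof
    fix x :: "int ^ 'n \<Rightarrow> bool" assume x: "x \<in> free_part"
    then have "openin (top_of_set free_part) {y \<in> topspace (top_of_set free_part). f y \<in> {f x}}"
      using K by (intro openin_continuous_map_preimage[OF f]) auto
    then obtain U where U: "open U" "{y \<in> free_part. f y \<in> {f x}} = free_part \<inter> U"
      by (auto simp: openin_open)
    with x have "x \<in> U"
      by auto
    with U(1) obtain H where H: "finite H" "{y. \<forall>h\<in>H. y h = x h} \<subseteq> U"
      by (rule open_contains_cylinder)
    have "f y = f x" if "y \<in> free_part" "\<forall>h\<in>H. y h = x h" for y
    proof -
      have "y \<in> free_part \<inter> U"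
        using H(2) that by blast
      then show ?thesis
        unfolding U(2)[symmetric] by simp
    qed
    with H(1) show "\<exists>H. finite H \<and> (\<forall>y\<in>free_part. (\<forall>h\<in>H. y h = x h) \<longrightarrow> f y = f x)"
      by (intro exI[of _ H]) simp
  qed
  ultimately show "f ` free_part \<subseteq> K \<and> finitary f"
    by blast
next
  assume f: "f ` free_part \<subseteq> K \<and> finitary f"
  have "openin (top_of_set free_part) {x \<in> free_part. f x \<in> U}" for U
  proof (subst openin_subopen, intro ballI)
    fix x :: "int ^ 'n \<Rightarrow> bool" assume x: "x \<in> {x \<in> free_part. f x \<in> U}"
    then have "finitary f" "x \<in> free_part"
      using f by auto
    then obtain H where H: "finite H" "\<forall>y\<in>free_part. (\<forall>h\<in>H. y h = x h) \<longrightarrow> f y = f x"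
      by (rule finitaryE)
    then have "openin (top_of_set free_part) (free_part \<inter> {y. \<forall>h\<in>H. y h = x h})"
      by (intro openin_open_Int open_cylinder)
    then show "\<exists>T. openin (top_of_set free_part) T \<and> x \<in> T \<and> T \<subseteq> {x \<in> free_part. f x \<in> U}"
    proof (intro exI conjI)
      show "free_part \<inter> {y. \<forall>h\<in>H. y h = x h} \<subseteq> {x \<in> free_part. f x \<in> U}"
      proof
        fix y assume "y \<in> free_part \<inter> {y. \<forall>h\<in>H. y h = x h}"
        then have "y \<in> free_part" "f y = f x"
          using H(2) by blast+
        with x show "y \<in> {x \<in> free_part. f x \<in> U}"
          by simp
      qed
    qed (use x in auto)
  qed
  with f show "continuous_map (top_of_set free_part) (discrete_topology K) f"
    by (simp add: continuous_map_def Pi_iff image_subset_iff)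
qed

section \<open>Clopen matchings\<close>

lemma finitary_conj: "finitary P \<Longrightarrow> finitary Q \<Longrightarrow> finitary (\<lambda>x. P x \<and> Q x)"
  by (rule finitary_compose2)

lemma finitary_disj: "finitary P \<Longrightarrow> finitary Q \<Longrightarrow> finitary (\<lambda>x. P x \<or> Q x)"
  by (rule finitary_compose2)

lemma finitary_not: "finitary P \<Longrightarrow> finitary (\<lambda>x. \<not> P x)"
  by (rule finitary_compose)

text \<open>A free point differs from each of its finitely many translates by \<open>G\<close> at
  some coordinate. Fixing its values at these coordinates and their translates gives a cylinder that
  no \<open>g\<close> in \<open>G\<close> maps into itself at any point; and there are only
  countably many cylinders.\<close>

lemma countable_independent_cover:
  fixes G :: "(int ^ 'n) set"
  assumes "finite G" "0 \<notin> G"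
  obtains C :: "nat \<Rightarrow> (int ^ 'n \<Rightarrow> bool) set"
  where "\<And>n. finitary (\<lambda>x. x \<in> C n)"
    and "\<And>n x g. x \<in> C n \<Longrightarrow> g \<in> G \<Longrightarrow> shift g x \<notin> C n"
    and "\<And>x. x \<in> free_part \<Longrightarrow> \<exists>n. x \<in> C n"
proof -
  define D :: "((int ^ 'n) \<times> bool) list \<Rightarrow> (int ^ 'n \<Rightarrow> bool) set"
    where "D l = {y. \<forall>p\<in>set l. y (fst p) = snd p}" for l
  \<comment> \<open>All finite lists of coordinate constraints are enumerated; a cylinder that is
    not independent is replaced by the empty set.\<close>
  define C where "C n = (let l = from_nat n in
    if \<forall>x\<in>D l. \<forall>g\<in>G. shift g x \<notin> D l then D l else {})" for n
  have fin_D: "finitary (\<lambda>x. x \<in> D l)" for l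
  proof -
    have "finitary (\<lambda>x. \<forall>p\<in>set l. x (fst p) = snd p)"
      unfolding finitary_def by (intro ballI exI[of _ "fst ` set l"]) simp
    then show ?thesis
      by (simp add: D_def)
  qed
  show ?thesis
  proof (rule that[of C])
    show "finitary (\<lambda>x. x \<in> C n)" for n
      using fin_D[of "from_nat n"] by (simp add: C_def Let_def)
  next
    fix n x g assume "x \<in> C n" "g \<in> G"
    then show "shift g x \<notin> C n"
      by (simp add: C_def Let_def split: if_splits)
  next
    fix x :: "int ^ 'n \<Rightarrow> bool" assume x: "x \<in> free_part"
    have "\<exists>h. x (h + g) \<noteq> x h" if "g \<in> G" for g
    proof (rule ccontr)
      assume "\<nexists>h. x (h + g) \<noteq> x h"
      then have "shift g x = x"
        by (simp add: shift_def)
      with x that assms(2) show False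
        by (simp add: shift_eq_self_iff)
    qed
    then obtain h where h: "\<And>g. g \<in> G \<Longrightarrow> x (h g + g) \<noteq> x (h g)"
      by metis
    have "finite (h ` G \<union> (\<lambda>g. h g + g) ` G)"
      using assms(1) by simp
    from finite_list[OF this] obtain hs where hs: "set hs = h ` G \<union> (\<lambda>g. h g + g) ` G"
      by blast
    define l where "l = map (\<lambda>k. (k, x k)) hs"
    have D: "D l = {y. \<forall>k\<in>set hs. y k = x k}"
      by (auto simp: D_def l_def)
    have "shift g y \<notin> D l" if "y \<in> D l" "g \<in> G" for y g
    proof
      assume "shift g y \<in> D l"
      with that(2) have "y (h g + g) = x (h g)"
        unfolding D hs by (simp add: shift_def)
      moreover have "y (h g + g) = x (h g + g)"
        using that unfolding D hs by blast
      ultimately show False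
        using h[OF that(2)] by simp
    qed
    then have "x \<in> C (to_nat l)"
      by (simp add: C_def D)
    then show "\<exists>n. x \<in> C n" ..
  qed
qed

text \<open>Greedy construction along the independent cover \<open>C\<close>: stage \<open>n\<close>
  adds all points of \<open>U\<close> in \<open>C n\<close> that have no neighbour so far. Since
  \<open>C n\<close> is independent, these can be added simultaneously.\<close>

lemma maximal_independent_set:
  fixes G :: "(int ^ 'n) set"
  assumes G: "finite G" "0 \<notin> G" "\<And>g. g \<in> G \<Longrightarrow> - g \<in> G"
    and U: "U \<subseteq> free_part" "finitary (\<lambda>x. x \<in> U)"
  obtains A where "A \<subseteq> U" "finitary (\<lambda>x. x \<in> A)"
    and "\<And>x g. x \<in> A \<Longrightarrow> g \<in> G \<Longrightarrow> shift g x \<notin> A"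
    and "\<And>x. x \<in> U \<Longrightarrow> x \<in> A \<or> (\<exists>g\<in>G. shift g x \<in> A)"
proof -
  obtain C :: "nat \<Rightarrow> (int ^ 'n \<Rightarrow> bool) set" where C: "\<And>n. finitary (\<lambda>x. x \<in> C n)"
    "\<And>n x g. x \<in> C n \<Longrightarrow> g \<in> G \<Longrightarrow> shift g x \<notin> C n"
    "\<And>x. x \<in> free_part \<Longrightarrow> \<exists>n. x \<in> C n"
    using countable_independent_cover[OF G(1,2)] by blast
  define A where "A = rec_nat {} (\<lambda>n B. B \<union> {x \<in> U \<inter> C n. \<forall>g\<in>G. shift g x \<notin> B})"
  have A_0: "A 0 = {}"
    and A_Suc: "A (Suc n) = A n \<union> {x \<in> U \<inter> C n. \<forall>g\<in>G. shift g x \<notin> A n}" for n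
    by (simp_all add: A_def)
  have mono: "A m \<subseteq> A n" if "m \<le> n" for m n
    using that by (rule lift_Suc_mono_le[rotated]) (auto simp: A_Suc)
  have sub: "A n \<subseteq> U" for n
    by (induction n) (auto simp: A_0 A_Suc)
  have fin: "finitary (\<lambda>x. x \<in> A n)" for n
  proof (induction n)
    case (Suc n)
    have "finitary (\<lambda>x. x \<in> A n \<or> ((x \<in> U \<and> x \<in> C n) \<and> (\<forall>g\<in>G. shift g x \<notin> A n)))"
      by (intro finitary_disj finitary_conj finitary_ball[OF G(1)] finitary_not C(1) U(2)
          Suc.IH finitary_shift[where f = "\<lambda>x. x \<in> A n"])
    then show ?case
      by (simp add: A_Suc)
  qed (simp add: A_0)
  have indep: "shift g x \<notin> A n" if "x \<in> A n" "g \<in> G" for n x g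
    using that
  proof (induction n arbitrary: x g)
    case (Suc n)
    have eq: "shift (- g) (shift g x) = x"
      by (simp add: shift_shift)
    show ?case
    proof
      assume "shift g x \<in> A (Suc n)"
      then consider "shift g x \<in> A n" | "shift g x \<in> C n" "\<forall>k\<in>G. shift k (shift g x) \<notin> A n"
        by (auto simp: A_Suc)
      then show False
      proof cases
        case 1
        then have "x \<in> A n"
          using Suc.prems by (auto simp: A_Suc)
        with Suc.IH Suc.prems(2) 1 show False
          by blast
      next
        \<comment> \<open>Both points would be new at stage \<open>n\<close>: \<open>x\<close>
          cannot be older, because \<open>- g\<close> is in \<open>G\<close> and would have blocked
          \<open>shift g x\<close>. Independence of \<open>C n\<close> forbids this.\<close>
        case 2
        then have "x \<notin> A n"
          using G(3)[OF Suc.prems(2)] eq by metis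
        then have "x \<in> C n"
          using Suc.prems(1) by (auto simp: A_Suc)
        with C(2) Suc.prems(2) 2(1) show False
          by blast
      qed
    qed
  qed (simp add: A_0)
  have dominated: "x \<in> A (Suc n) \<or> (\<exists>g\<in>G. shift g x \<in> A n)" if "x \<in> U" "x \<in> C n" for x n
    using that by (auto simp: A_Suc)
  define B where "B = (\<Union>n. A n)"
  have indep_B: "shift g x \<notin> B" if "x \<in> B" "g \<in> G" for x g
  proof
    assume "shift g x \<in> B"
    with that(1) obtain m n where "x \<in> A m" "shift g x \<in> A n"
      by (auto simp: B_def)
    with mono[of m "max m n"] mono[of n "max m n"] have "x \<in> A (max m n)" "shift g x \<in> A (max m n)"
      by auto
    with indep that(2) show False
      by blast
  qed
  \<comment> \<open>For a point of \<open>C n\<close> the infinite construction is settled after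
    stage \<open>n\<close>. A finite window for \<open>C n\<close> and \<open>A (Suc n)\<close>
    therefore decides membership in \<open>B\<close>, which makes the union clopen.\<close>
  have decide: "x \<in> B \<longleftrightarrow> x \<in> A (Suc n)" if "x \<in> C n" for x n
  proof
    assume x: "x \<in> B"
    with sub have "x \<in> U"
      by (auto simp: B_def)
    moreover have "shift g x \<notin> A n" if "g \<in> G" for g
      using indep_B[OF x that] by (auto simp: B_def)
    ultimately show "x \<in> A (Suc n)"
      using dominated that by blast
  qed (auto simp: B_def)
  show ?thesis
  proof (rule that[of B])
    show "B \<subseteq> U"
      using sub by (auto simp: B_def)
    show "finitary (\<lambda>x. x \<in> B)"
      unfolding finitary_def
    proof
      fix x :: "int ^ 'n \<Rightarrow> bool" assume x: "x \<in> free_part"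
      then obtain n where n: "x \<in> C n"
        using C(3) by blast
      have "finitary (\<lambda>x. (x \<in> C n, x \<in> A (Suc n)))"
        by (intro finitary_compose2[where k = Pair] C fin)
      then obtain H where H: "finite H" "\<forall>y\<in>free_part. (\<forall>h\<in>H. y h = x h) \<longrightarrow>
          (y \<in> C n, y \<in> A (Suc n)) = (x \<in> C n, x \<in> A (Suc n))"
        by (rule finitaryE[OF _ x])
      have "(y \<in> B) = (x \<in> B)" if "y \<in> free_part" "\<forall>h\<in>H. y h = x h" for y
      proof -
        have "y \<in> C n" "y \<in> A (Suc n) \<longleftrightarrow> x \<in> A (Suc n)"
          using H(2)[rule_format, OF that(1)] that(2) n by blast+
        with decide n show ?thesis
          by simp
      qed
      with H(1) show "\<exists>H. finite H \<and> (\<forall>y\<in>free_part. (\<forall>h\<in>H. y h = x h) \<longrightarrow> (y \<in> B) = (x \<in> B))"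
        by (intro exI[of _ H]) simp
    qed
    show "x \<in> B \<or> (\<exists>g\<in>G. shift g x \<in> B)" if "x \<in> U" for x
    proof -
      from C(3) that U(1) obtain n where n: "x \<in> C n"
        by blast
      from dominated[OF that n] show ?thesis
        by (auto simp: B_def)
    qed
  qed (use indep_B in blast)
qed

section \<open>Sparse sets that recur on every line\<close>

lemma shift_smult_add: "shift (a *s s) (shift (b *s s) x) = shift ((a + b) *s s) x"
  for a b :: int
  by (simp add: shift_shift vector_sadd_rdistrib)

text \<open>
  If a line segment of \<open>card D + 1\<close> windows missed \<open>A\<close>, each window would contain a point of \<open>U\<close>
  excluded from \<open>A\<close> by some \<open>d \<in> D\<close>; two windows sharing the same \<open>d\<close> would then yield
  two points of \<open>A\<close> on one line whose distance is excluded by the choice of \<open>A\<close>.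
\<close>

lemma line_recurrent_subset:
  fixes s :: "int ^ 'n" and D :: "(int ^ 'n) set"
  assumes "s \<noteq> 0" and D: "finite D" "0 \<notin> D" "\<And>d. d \<in> D \<Longrightarrow> - d \<in> D"
    and U: "U \<subseteq> free_part" "finitary (\<lambda>x. x \<in> U)"
    and R: "\<And>x. x \<in> free_part \<Longrightarrow> \<exists>t. 0 \<le> t \<and> t < R \<and> shift (t *s s) x \<in> U"
  obtains A where "A \<subseteq> U" "finitary (\<lambda>x. x \<in> A)"
    and "\<And>x d. x \<in> A \<Longrightarrow> d \<in> D \<Longrightarrow> shift d x \<notin> A"
    and "\<And>x. x \<in> free_part \<Longrightarrow> \<exists>t::nat. shift (- int t *s s) x \<in> A"
proof -
  have "0 < R"
    using R[OF free_part_nonempty] by force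
  \<comment> \<open>\<open>N\<close> is the length of \<open>card D + 1\<close> windows of length
    \<open>R\<close>. Points of \<open>A\<close> on one line are kept at least \<open>N\<close>
    apart through \<open>L\<close>, besides the prescribed exclusions \<open>D\<close>.\<close>
  define N where "N = R * (int (card D) + 1)"
  define L where "L = {t *s s |t. - N < t \<and> t < N \<and> t \<noteq> 0}"
  define G where "G = D \<union> L"
  have G: "finite G" "0 \<notin> G" "\<And>g. g \<in> G \<Longrightarrow> - g \<in> G"
  proof -
    have "L \<subseteq> (\<lambda>t. t *s s) ` {- N<..<N}"
      by (auto simp: L_def)
    then have "finite L"
      by (rule finite_subset) simp
    with D \<open>s \<noteq> 0\<close> show "finite G" "0 \<notin> G"
      by (auto simp: G_def L_def)
    show "- g \<in> G" if "g \<in> G" for g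
    proof (cases "g \<in> D")
      case False
      with that obtain t where "- N < t" "t < N" "t \<noteq> 0" "g = t *s s"
        unfolding G_def L_def by blast
      then have "- g = (- t) *s s \<and> - N < - t \<and> - t < N \<and> - t \<noteq> 0"
        by (simp add: vector_smult_lneg)
      then have "- g \<in> L"
        unfolding L_def by blast
      then show ?thesis
        by (simp add: G_def)
    qed (use D in \<open>simp add: G_def\<close>)
  qed
  obtain A where A: "A \<subseteq> U" "finitary (\<lambda>x. x \<in> A)"
    "\<And>x g. x \<in> A \<Longrightarrow> g \<in> G \<Longrightarrow> shift g x \<notin> A"
    "\<And>x. x \<in> U \<Longrightarrow> x \<in> A \<or> (\<exists>g\<in>G. shift g x \<in> A)"
    using maximal_independent_set[OF G U] by blast
  \<comment> \<open>A point of \<open>U\<close> among the windows lies at a position between 0 and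
    \<open>N\<close>, and a neighbour of it by \<open>L\<close> is less than \<open>N\<close>
    further away. So if \<open>A\<close> is absent from this range, only elements of
    \<open>D\<close> can exclude these points.\<close>
  have near: "\<exists>t. \<bar>t\<bar> < 2 * N \<and> shift (t *s s) x \<in> A" if x: "x \<in> free_part" for x
  proof (rule ccontr)
    assume none: "\<not> ?thesis"
    have "\<exists>t d. int q * R \<le> t \<and> t < (int q + 1) * R \<and> d \<in> D \<and> shift (d + t *s s) x \<in> A"
      if q: "q \<le> card D" for q
    proof -
      obtain t where t: "0 \<le> t" "t < R" "shift (t *s s) (shift ((int q * R) *s s) x) \<in> U"
        using R[of "shift ((int q * R) *s s) x"] x by auto
      define u where "u = t + int q * R"
      have u: "int q * R \<le> u" "u < (int q + 1) * R" "shift (u *s s) x \<in> U"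
        using t by (auto simp: u_def shift_smult_add algebra_simps)
      have "(int q + 1) * R \<le> N"
        unfolding N_def using q \<open>0 < R\<close> by (simp add: mult.commute mult_left_mono)
      moreover have "0 \<le> int q * R"
        using \<open>0 < R\<close> by simp
      ultimately have "0 \<le> u" "u < N"
        using u by linarith+
      have "shift (u *s s) x \<notin> A"
        using none \<open>0 \<le> u\<close> \<open>u < N\<close> by force
      with A(4)[OF u(3)] obtain g where g: "g \<in> G" "shift (g + u *s s) x \<in> A"
        by (auto simp: shift_shift)
      have "g \<notin> L"
      proof
        assume "g \<in> L"
        then obtain r where "- N < r" "r < N" "g = r *s s"
          unfolding L_def by blast
        with g(2) have "\<bar>r + u\<bar> < 2 * N" "shift ((r + u) *s s) x \<in> A"
          using \<open>0 \<le> u\<close> \<open>u < N\<close> by (auto simp: vector_sadd_rdistrib)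
        with none show False
          by blast
      qed
      with g u show ?thesis
        by (auto simp: G_def)
    qed
    then obtain t d where td: "\<And>q. q \<le> card D \<Longrightarrow> int q * R \<le> t q \<and> t q < (int q + 1) * R \<and>
        d q \<in> D \<and> shift (d q + t q *s s) x \<in> A"
      by metis
    have "card (d ` {..card D}) \<le> card D"
      using td by (intro card_mono D) auto
    then have "\<not> inj_on d {..card D}"
      by (intro pigeonhole) simp
    then obtain p q where pq: "p \<le> card D" "q \<le> card D" "p < q" "d p = d q"
      unfolding inj_on_def by (metis atMost_iff nat_neq_iff)
    have "(int p + 1) * R \<le> int q * R" "(int q + 1) * R \<le> N" "0 \<le> int p * R"
      unfolding N_def using pq \<open>0 < R\<close> by (auto simp: mult.commute mult_left_mono)
    then have "0 < t q - t p" "t q - t p < N"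
      using td[OF pq(1)] td[OF pq(2)] by linarith+
    then have "- N < t q - t p \<and> t q - t p < N \<and> t q - t p \<noteq> 0"
      by linarith
    then have "(t q - t p) *s s \<in> G"
      unfolding G_def L_def by blast
    from A(3)[OF conjunct2[OF conjunct2[OF conjunct2[OF td[OF pq(1)]]]] this]
    moreover have "(t q - t p) *s s + (d p + t p *s s) = d q + t q *s s"
      by (simp add: vec_eq_iff pq(4) algebra_simps)
    ultimately have "shift (d q + t q *s s) x \<notin> A"
      by (metis shift_shift)
    with td[OF pq(2)] show False
      by blast
  qed
  show ?thesis
  proof (rule that[of A])
    show "\<exists>t::nat. shift (- int t *s s) x \<in> A" if x: "x \<in> free_part" for x
    proof -
      \<comment> \<open>Starting \<open>2 * N\<close> steps back turns the two-sided bound into a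
        point of \<open>A\<close> behind \<open>x\<close>.\<close>
      obtain t where t: "\<bar>t\<bar> < 2 * N" "shift (t *s s) (shift ((- 2 * N) *s s) x) \<in> A"
        using near[of "shift ((- 2 * N) *s s) x"] x by auto
      have "t + - 2 * N = - int (nat (2 * N - t))"
        using t(1) by simp
      with t(2) have "shift (- int (nat (2 * N - t)) *s s) x \<in> A"
        by (simp only: shift_smult_add)
      then show ?thesis ..
    qed
    show "shift d x \<notin> A" if "x \<in> A" "d \<in> D" for x d
      using A(3) that by (simp add: G_def)
  qed (fact A)+
qed

text \<open>\<open>A s\<close> holds the base points \<open>x\<close> of the chosen edges
  \<open>{x, shift s x}\<close>. Directions are added one by one: since the earlier sets are sparse,
  the edges in a new direction disjoint from them recur on every line, and
  \<open>line_recurrent_subset\<close> selects a sparse set of them.\<close>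

lemma sparse_matching:
  fixes P :: "(int ^ 'n) set"
  assumes P: "finite P" "0 \<notin> P"
  obtains A where "\<And>s. s \<in> P \<Longrightarrow> finitary (\<lambda>x. x \<in> A s)"
    and "\<And>s x. s \<in> P \<Longrightarrow> x \<in> A s \<Longrightarrow> shift s x \<notin> A s"
    and "\<And>s x. s \<in> P \<Longrightarrow> x \<in> free_part \<Longrightarrow> \<exists>t::nat. shift (- int t *s s) x \<in> A s"
    and "\<And>s s' x y. s \<in> P \<Longrightarrow> s' \<in> P \<Longrightarrow> s \<noteq> s' \<Longrightarrow> x \<in> A s \<Longrightarrow> y \<in> A s' \<Longrightarrow>
           {x, shift s x} \<inter> {y, shift s' y} = {}"
proof -
  \<comment> \<open>Among \<open>R\<close> consecutive edges of a line, each earlier direction blocks at most four: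
    one for each choice of the end points \<open>e\<close>, \<open>e'\<close> that coincide.\<close>
  define R where "R = int (4 * card P + 2)"
  \<comment> \<open>Sparseness is imposed along all directions in \<open>P\<close> at once, because
    directions treated later need it on their own lines.\<close>
  define D where "D = {t *s v |t v. - R < t \<and> t < R \<and> t \<noteq> 0 \<and> v \<in> P}"
  have D: "finite D" "0 \<notin> D" "\<And>d. d \<in> D \<Longrightarrow> - d \<in> D"
  proof -
    have "D \<subseteq> (\<lambda>(t, v). t *s v) ` ({- R<..<R} \<times> P)"
      by (auto simp: D_def)
    then show "finite D"
      by (rule finite_subset) (use P in simp)
    show "0 \<notin> D"
      using P by (auto simp: D_def)
    show "- d \<in> D" if "d \<in> D" for d
    proof -
      from that obtain t v where "- R < t" "t < R" "t \<noteq> 0" "v \<in> P" "d = t *s v"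
        unfolding D_def by blast
      then have "- d = (- t) *s v \<and> - R < - t \<and> - t < R \<and> - t \<noteq> 0 \<and> v \<in> P"
        by (simp add: vector_smult_lneg)
      then show ?thesis
        unfolding D_def by blast
    qed
  qed
  \<comment> \<open>The multiple 1 is among the excluded ones, so consecutive edges of a line are
    never both chosen.\<close>
  have "P \<subseteq> D"
  proof
    fix s assume "s \<in> P"
    then have "s = 1 *s s \<and> - R < 1 \<and> 1 < R \<and> (1::int) \<noteq> 0 \<and> s \<in> P"
      by (simp add: R_def)
    then show "s \<in> D"
      unfolding D_def by blast
  qed
  define good where "good Q A \<longleftrightarrow> (\<forall>s\<in>Q. finitary (\<lambda>x. x \<in> A s)) \<and>
      (\<forall>s\<in>Q. \<forall>x\<in>A s. \<forall>d\<in>D. shift d x \<notin> A s) \<and>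
      (\<forall>s\<in>Q. \<forall>x\<in>free_part. \<exists>t::nat. shift (- int t *s s) x \<in> A s) \<and>
      (\<forall>s\<in>Q. \<forall>s'\<in>Q. s \<noteq> s' \<longrightarrow> (\<forall>x\<in>A s. \<forall>y\<in>A s'. {x, shift s x} \<inter> {y, shift s' y} = {}))"
    for Q and A :: "int ^ 'n \<Rightarrow> (int ^ 'n \<Rightarrow> bool) set"
  have "\<exists>A. good Q A" if "Q \<subseteq> P" for Q
    using finite_subset[OF that P(1)] that
  proof (induction Q rule: finite_induct)
    case (insert s Q)
    then obtain A where "good Q A"
      by blast
    note good_A = this[unfolded good_def]
    note A = good_A[THEN conjunct1, rule_format]
      good_A[THEN conjunct2, THEN conjunct1, rule_format]
      good_A[THEN conjunct2, THEN conjunct2, THEN conjunct1, rule_format]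
      good_A[THEN conjunct2, THEN conjunct2, THEN conjunct2, rule_format]
    \<comment> \<open>The edges at \<open>x\<close> in direction \<open>s\<close> and at
      \<open>y\<close> in direction \<open>s'\<close> meet iff \<open>shift e x = shift e' y\<close>
      for some end points \<open>e\<close>, \<open>e'\<close>, that is,
      \<open>y = shift (e - e') x\<close>. Thus \<open>U\<close> collects the base points of edges
      missing every earlier chosen edge.\<close>
    define U where "U = {x \<in> free_part. \<forall>s'\<in>Q. \<forall>e\<in>{0, s}. \<forall>e'\<in>{0, s'}. shift (e - e') x \<notin> A s'}"
    have s: "s \<in> P" "s \<noteq> 0"
      using insert.prems P(2) by auto
    have U: "U \<subseteq> free_part" "finitary (\<lambda>x. x \<in> U)"
    proof -
      have "finitary (\<lambda>x. \<forall>s'\<in>Q. \<forall>e\<in>{0, s}. \<forall>e'\<in>{0, s'}. shift (e - e') x \<notin> A s')"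
        using A(1) insert.hyps(1)
        by (intro finitary_ball finitary_not finitary_shift[where f = "\<lambda>x. x \<in> A _"]) auto
      then show "finitary (\<lambda>x. x \<in> U)"
        by (rule finitary_depends) (simp add: U_def)
    qed (auto simp: U_def)
    have "\<exists>t. 0 \<le> t \<and> t < R \<and> shift (t *s s) x \<in> U" if x: "x \<in> free_part" for x
    proof (rule ccontr)
      assume none: "\<not> ?thesis"
      \<comment> \<open>\<open>E\<close> lists the possible reasons why an edge is blocked. With
        fewer than \<open>R\<close> of them, two of \<open>R\<close> consecutive blocked edges share
        a reason, which puts two points of one \<open>A s'\<close> a short multiple of
        \<open>s\<close> apart, against the choice of \<open>D\<close>.\<close>
      define E where "E = (SIGMA s':Q. {0, s} \<times> {0, s'})"
      have "\<exists>p. p \<in> E \<and> shift (fst (snd p) - snd (snd p)) (shift (t *s s) x) \<in> A (fst p)"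
        if t: "t \<in> {0..<R}" for t
      proof -
        have "shift (t *s s) x \<notin> U"
          using none t by auto
        then obtain s' e e' where "s' \<in> Q" "e \<in> {0, s}" "e' \<in> {0, s'}"
            "shift (e - e') (shift (t *s s) x) \<in> A s'"
          unfolding U_def using x by (auto simp only: mem_Collect_eq shift_in_free_part)
        then show ?thesis
          by (intro exI[of _ "(s', e, e')"]) (auto simp: E_def)
      qed
      then obtain p where p: "\<And>t. t \<in> {0..<R} \<Longrightarrow> p t \<in> E"
        "\<And>t. t \<in> {0..<R} \<Longrightarrow>
           shift (fst (snd (p t)) - snd (snd (p t))) (shift (t *s s) x) \<in> A (fst (p t))"
        by metis
      have "finite E"
        using insert.hyps(1) by (auto simp: E_def)
      have "card E = (\<Sum>s'\<in>Q. card ({0, s} \<times> {0, s'}))"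
        unfolding E_def using insert.hyps(1) by (intro card_SigmaI) auto
      also have "\<dots> \<le> (\<Sum>s'\<in>Q. 4)"
      proof (rule sum_mono)
        fix s' :: "int ^ 'n"
        have "card {0, s} * card {0, s'} \<le> 2 * 2"
          by (intro mult_mono) (auto simp: card_insert_if)
        then show "card ({0, s} \<times> {0, s'}) \<le> 4"
          by (simp only: card_cartesian_product)
      qed
      also have "\<dots> \<le> 4 * card P"
        using insert.prems P(1) by (simp add: card_mono)
      also have "\<dots> < card {0..<R}"
        by (simp add: R_def)
      finally have "card E < card {0..<R}" .
      moreover have "card (p ` {0..<R}) \<le> card E"
        using p(1) \<open>finite E\<close> by (intro card_mono) auto
      ultimately have "\<not> inj_on p {0..<R}"
        by (intro pigeonhole) simp
      then obtain t u where tu: "t \<in> {0..<R}" "u \<in> {0..<R}" "t < u" "p t = p u"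
        unfolding inj_on_def by (metis linorder_neq_iff)
      obtain s' e e' where pt: "p t = (s', e, e')"
        by (cases "p t") auto
      have "s' \<in> Q"
        using p(1)[OF tu(1)] by (simp add: pt E_def)
      moreover have "shift (e - e') (shift (t *s s) x) \<in> A s'"
        using p(2)[OF tu(1)] by (simp add: pt)
      moreover have "(u - t) *s s \<in> D"
      proof -
        have "- R < u - t \<and> u - t < R \<and> u - t \<noteq> 0 \<and> s \<in> P"
          using tu s(1) by auto
        then show ?thesis
          unfolding D_def by blast
      qed
      ultimately have "shift ((u - t) *s s) (shift (e - e') (shift (t *s s) x)) \<notin> A s'"
        by (rule A(2))
      moreover have "(u - t) *s s + (e - e' + t *s s) = e - e' + u *s s"
        by (simp add: vec_eq_iff algebra_simps)
      ultimately have "shift (e - e') (shift (u *s s) x) \<notin> A s'"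
        by (metis shift_shift)
      then show False
        using p(2)[OF tu(2)] by (simp add: pt flip: tu(4))
    qed
    then obtain B where B: "B \<subseteq> U" "finitary (\<lambda>x. x \<in> B)"
      "\<And>x d. x \<in> B \<Longrightarrow> d \<in> D \<Longrightarrow> shift d x \<notin> B"
      "\<And>x. x \<in> free_part \<Longrightarrow> \<exists>t::nat. shift (- int t *s s) x \<in> B"
      using line_recurrent_subset[OF s(2) D U] by blast
    have disj: "{x, shift s x} \<inter> {y, shift s' y} = {}" if "x \<in> B" "s' \<in> Q" "y \<in> A s'" for x s' y
    proof (rule ccontr)
      assume "\<not> ?thesis"
      then have "(\<lambda>e. shift e x) ` {0, s} \<inter> (\<lambda>e. shift e y) ` {0, s'} \<noteq> {}"
        by simp
      then obtain e e' where "e \<in> {0, s}" "e' \<in> {0, s'}" "shift e x = shift e' y"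
        by blast
      moreover from this have "y = shift (e - e') x"
        by (simp add: shift_eq_shift_iff)
      ultimately show False
        using that B(1) unfolding U_def by blast
    qed
    have "good (insert s Q) (A(s := B))"
      unfolding good_def
    proof (intro conjI)
      show "\<forall>r\<in>insert s Q. finitary (\<lambda>x. x \<in> (A(s := B)) r)"
        using A(1) B(2) by simp
      show "\<forall>r\<in>insert s Q. \<forall>x\<in>(A(s := B)) r. \<forall>d\<in>D. shift d x \<notin> (A(s := B)) r"
        using A(2) B(3) by simp
      show "\<forall>r\<in>insert s Q. \<forall>x\<in>free_part. \<exists>t::nat. shift (- int t *s r) x \<in> (A(s := B)) r"
        using A(3) B(4) by simp
      show "\<forall>r\<in>insert s Q. \<forall>r'\<in>insert s Q. r \<noteq> r' \<longrightarrow>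
          (\<forall>x\<in>(A(s := B)) r. \<forall>y\<in>(A(s := B)) r'. {x, shift r x} \<inter> {y, shift r' y} = {})"
      proof (intro ballI impI)
        fix r r' x y assume *: "r \<in> insert s Q" "r' \<in> insert s Q" "r \<noteq> r'"
          "x \<in> (A(s := B)) r" "y \<in> (A(s := B)) r'"
        consider "r = s" | "r' = s" "r \<noteq> s" | "r \<noteq> s" "r' \<noteq> s"
          by blast
        then show "{x, shift r x} \<inter> {y, shift r' y} = {}"
        proof cases
          case 1
          with * show ?thesis
            using disj[of x r' y] by simp
        next
          case 2
          with * show ?thesis
            using disj[of y r x] by (simp add: Int_commute)
        next
          case 3
          with * show ?thesis
            using A(4)[of r r' x y] by simp
        qed
      qed
    qed
    then show ?case by (rule exI[of "good (insert s Q)"])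
  qed (rule exI[of "good {}"], simp add: good_def)
  from this[OF order_refl] obtain A where "good P A"
    by blast
  note A = this[unfolded good_def, THEN conjunct1, rule_format]
    this[unfolded good_def, THEN conjunct2, THEN conjunct1, rule_format]
    this[unfolded good_def, THEN conjunct2, THEN conjunct2, THEN conjunct1, rule_format]
    this[unfolded good_def, THEN conjunct2, THEN conjunct2, THEN conjunct2, rule_format]
  show ?thesis
  proof (rule that[of A])
    show "shift s x \<notin> A s" if "s \<in> P" "x \<in> A s" for s x
      using A(2) that \<open>P \<subseteq> D\<close> by blast
  qed (fact A)+
qed

section \<open>Edge colourings\<close>

text \<open>A least value \<open>n\<close> is certified by the truth values of \<open>P 0\<close>,
  ..., \<open>P n\<close> alone, so a finite window suffices at each point although the search has
  no uniform bound.\<close>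

lemma finitary_Least:
  fixes P :: "nat \<Rightarrow> (int ^ 'n \<Rightarrow> bool) \<Rightarrow> bool"
  assumes "\<And>t. finitary (P t)" and ex: "\<And>x. x \<in> free_part \<Longrightarrow> \<exists>t. P t x"
  shows "finitary (\<lambda>x. LEAST t. P t x)"
  unfolding finitary_def
proof
  fix x :: "int ^ 'n \<Rightarrow> bool" assume x: "x \<in> free_part"
  define n where "n = (LEAST t. P t x)"
  have n: "P n x" "\<And>t. t < n \<Longrightarrow> \<not> P t x"
    using ex[OF x] by (auto simp: n_def intro: LeastI_ex dest: not_less_Least)
  have "finitary (\<lambda>y. \<forall>t\<in>{..n}. P t y = P t x)"
    by (intro finitary_ball finitary_compose[OF assms(1)]) simp
  then obtain H where H: "finite H" "\<forall>y\<in>free_part. (\<forall>h\<in>H. y h = x h) \<longrightarrow>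
      (\<forall>t\<in>{..n}. P t y = P t x) = (\<forall>t\<in>{..n}. P t x = P t x)"
    by (rule finitaryE[OF _ x])
  have "(LEAST t. P t y) = n" if "y \<in> free_part" "\<forall>h\<in>H. y h = x h" for y
  proof (rule Least_equality)
    have eq: "P t y = P t x" if "t \<le> n" for t
      using H(2)[rule_format, OF \<open>y \<in> free_part\<close>] \<open>\<forall>h\<in>H. y h = x h\<close> that by blast
    show "P n y"
      using eq n by simp
    show "n \<le> t" if "P t y" for t
      using eq[of t] n(2)[of t] that by (cases "n \<le> t") auto
  qed
  with H(1) show "\<exists>H. finite H \<and> (\<forall>y\<in>free_part. (\<forall>h\<in>H. y h = x h) \<longrightarrow>
      (LEAST t. P t y) = (LEAST t. P t x))"
    unfolding n_def by (intro exI[of _ H]) simp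
qed

text \<open>No nonzero vector equals its negative. The choice \<open>r\<close> depends only on the
  unordered pair of \<open>s\<close> and \<open>- s\<close>, so it selects exactly one member of
  each pair.\<close>

lemma symmetric_half:
  fixes S :: "(int ^ 'n) set"
  assumes "finite S" "uminus ` S = S" "0 \<notin> S"
  obtains P where "P \<subseteq> S" "\<And>s. s \<in> S \<Longrightarrow> s \<in> P \<or> - s \<in> P" "\<And>s. s \<in> P \<Longrightarrow> - s \<notin> P"
    "card S = 2 * card P"
proof -
  define r where "r s = (SOME t. t \<in> {s, - s})" for s :: "int ^ 'n"
  have r: "r s = s \<or> r s = - s" for s
    using someI[of "\<lambda>t. t \<in> {s, - s}" s] by (auto simp: r_def)
  have r_minus: "r (- s) = r s" for s
    by (simp add: r_def insert_commute)
  have ne: "- s \<noteq> s" if "s \<in> S" for s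
  proof
    assume "- s = s"
    then have "s = 0"
      by (simp add: vec_eq_iff)
    with that assms(3) show False
      by simp
  qed
  have minus: "- s \<in> S" if "s \<in> S" for s
    using assms(2) that by blast
  define P where "P = {s \<in> S. r s = s}"
  have dis: "- s \<notin> P" if "s \<in> P" for s
    using that ne[of s] r_minus[of s] by (auto simp: P_def)
  have cov: "s \<in> P \<or> - s \<in> P" if "s \<in> S" for s
    using that r[of s] r_minus[of s] minus by (auto simp: P_def)
  have "S = P \<union> uminus ` P"
  proof
    show "S \<subseteq> P \<union> uminus ` P"
    proof
      fix s assume "s \<in> S"
      then show "s \<in> P \<union> uminus ` P"
        using cov[of s] by (metis UnCI image_eqI minus_minus)
    qed
    show "P \<union> uminus ` P \<subseteq> S"
      using minus by (auto simp: P_def)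
  qed
  moreover have "card (P \<union> uminus ` P) = card P + card (uminus ` P)"
    using assms(1) dis by (intro card_Un_disjoint) (auto simp: P_def)
  moreover have "card (uminus ` P) = card P"
    by (intro card_image) (simp add: inj_on_def)
  ultimately have "card S = 2 * card P"
    by simp
  with dis cov show ?thesis
    by (intro that[of P]) (auto simp: P_def)
qed

text \<open>If the edge were read from its other end, freeness would force \<open>s' = - s\<close>,
  which cannot lie in \<open>P\<close>. Hence colours may be prescribed on directed edges with
  direction in \<open>P\<close>.\<close>

lemma edge_orientation_unique:
  assumes "\<And>s. s \<in> P \<Longrightarrow> - s \<notin> P" "s \<in> P" "s' \<in> P" "x \<in> free_part"
    and eq: "{x, shift s x} = {y, shift s' y}"
  shows "s = s' \<and> x = y"
proof (cases "x = y")
  case True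
  with eq have "shift s x = shift s' x"
    by (auto simp: doubleton_eq_iff)
  with True assms(4) show ?thesis
    by (simp add: shift_eq_iff)
next
  case False
  with eq have "x = shift s' y" "shift s x = y"
    by (auto simp: doubleton_eq_iff)
  then have "shift (s' + s) x = x"
    by (simp flip: shift_shift)
  with assms(4) have "s' = - s"
    by (simp add: shift_eq_self_iff eq_neg_iff_add_eq_0)
  with assms(1)[OF assms(2)] assms(3) show ?thesis
    by simp
qed

text \<open>Every edge has exactly one description by a base point and a direction in
  \<open>P\<close>, so \<open>f\<close> defines a colouring. Adjacent edges in one direction are
  consecutive on a line, which \<open>line\<close> covers; \<open>cross\<close> covers different
  directions.\<close>

lemma edge_coloring_of_directions:
  fixes S :: "(int ^ 'n) set"
  assumes P: "P \<subseteq> S" "\<And>s. s \<in> S \<Longrightarrow> s \<in> P \<or> - s \<in> P" "\<And>s. s \<in> P \<Longrightarrow> - s \<notin> P"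
    and bound: "\<And>s x. s \<in> P \<Longrightarrow> x \<in> free_part \<Longrightarrow> f s x < k"
    and line: "\<And>s x. s \<in> P \<Longrightarrow> x \<in> free_part \<Longrightarrow> f s (shift s x) \<noteq> f s x"
    and cross: "\<And>s s' x y. s \<in> P \<Longrightarrow> s' \<in> P \<Longrightarrow> s \<noteq> s' \<Longrightarrow> x \<in> free_part \<Longrightarrow> y \<in> free_part \<Longrightarrow>
                  {x, shift s x} \<inter> {y, shift s' y} \<noteq> {} \<Longrightarrow> f s x \<noteq> f s' y"
  shows "\<exists>c. proper_edge_coloring (schreier_graph S) {..<k::nat} c \<and>
           (\<forall>s\<in>P. \<forall>x\<in>free_part. c {x, shift s x} = f s x)"
proof -
  define rep where "rep e sx \<longleftrightarrow> fst sx \<in> P \<and> snd sx \<in> free_part \<and> e = {snd sx, shift (fst sx) (snd sx)}"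
    for e and sx :: "(int ^ 'n) \<times> (int ^ 'n \<Rightarrow> bool)"
  define c where "c e = (case (SOME sx. rep e sx) of (s, x) \<Rightarrow> f s x)" for e
  have c: "c {x, shift s x} = f s x" if "s \<in> P" "x \<in> free_part" for s x
  proof -
    have rep: "rep {x, shift s x} (s, x)"
      using that by (simp add: rep_def)
    have "sx = (s, x)" if "rep {x, shift s x} sx" for sx
    proof -
      have "s = fst sx \<and> x = snd sx"
        using that \<open>s \<in> P\<close> \<open>x \<in> free_part\<close> by (intro edge_orientation_unique[OF P(3)]) (auto simp: rep_def)
      then show ?thesis
        by (simp add: prod_eq_iff)
    qed
    with rep have "(SOME sx. rep {x, shift s x} sx) = (s, x)"
      by (rule some_equality)
    then show ?thesis
      by (simp add: c_def)
  qed
  have edge: "\<exists>s x. s \<in> P \<and> x \<in> free_part \<and> e = {x, shift s x}" if "e \<in> snd (schreier_graph S)" for e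
  proof -
    from that obtain s x where e: "s \<in> S" "x \<in> free_part" "e = {x, shift s x}"
      by (auto simp: schreier_graph_def)
    show ?thesis
    proof (cases "s \<in> P")
      case True
      with e show ?thesis
        by blast
    next
      case False
      have "e = {shift s x, shift (- s) (shift s x)}"
        using e(3) by (simp add: shift_shift insert_commute)
      moreover have "- s \<in> P" "shift s x \<in> free_part"
        using False P(2) e by auto
      ultimately show ?thesis
        by blast
    qed
  qed
  show ?thesis
  proof (intro exI conjI)
    show "proper_edge_coloring (schreier_graph S) {..<k} c"
      unfolding proper_edge_coloring_def
    proof (intro conjI ballI impI subsetI)
      fix v assume "v \<in> c ` snd (schreier_graph S)"
      then obtain e where "e \<in> snd (schreier_graph S)" "v = c e"
        by blast
      with edge[of e] c bound show "v \<in> {..<k}"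
        by auto
    next
      fix e e' assume e: "e \<in> snd (schreier_graph S)" "e' \<in> snd (schreier_graph S)"
        "e \<noteq> e' \<and> e \<inter> e' \<noteq> {}"
      obtain s x where x: "s \<in> P" "x \<in> free_part" "e = {x, shift s x}"
        using edge[OF e(1)] by blast
      obtain s' y where y: "s' \<in> P" "y \<in> free_part" "e' = {y, shift s' y}"
        using edge[OF e(2)] by blast
      have "f s x \<noteq> f s' y"
      proof (cases "s = s'")
        case False
        with x y e(3) show ?thesis
          by (intro cross) auto
      next
        case True
        have "x \<noteq> y"
          using True e(3) x(3) y(3) by auto
        moreover from this have "shift s x \<noteq> shift s y"
          by (simp add: shift_eq_shift_iff)
        ultimately have "x = shift s y \<or> y = shift s x"
          using True e(3) x(3) y(3) by auto
        then show ?thesis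
          using line[OF x(1) x(2)] line[OF x(1) y(2)] True by auto
      qed
      then show "c e \<noteq> c e'"
        using c x y by simp
    qed
  qed (use c in blast)
qed

text \<open>Choice fixes an origin on each line: the predicate inside \<open>SOME\<close> is the
  same for all points of a line. Free lines are infinite, so the position relative to the origin is
  unique, and its parity alternates. Nothing is claimed about continuity.\<close>

lemma line_parity:
  fixes s :: "int ^ 'n"
  assumes "s \<noteq> 0"
  shows "\<exists>p. \<forall>x\<in>free_part. p (shift s x) \<longleftrightarrow> \<not> p x"
proof -
  define r where "r x = (SOME y. \<exists>t::int. y = shift (t *s s) x)" for x
  have r: "\<exists>t::int. r x = shift (t *s s) x" for x
    unfolding r_def by (rule someI[where x = "shift (0 *s s) x"]) (rule exI[of _ 0], rule refl)
  have r_shift: "r (shift s x) = r x" for x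
  proof -
    have "(\<exists>t::int. y = shift (t *s s) (shift s x)) \<longleftrightarrow> (\<exists>t::int. y = shift (t *s s) x)" for y
    proof
      assume "\<exists>t::int. y = shift (t *s s) (shift s x)"
      then obtain t :: int where "y = shift (t *s s) (shift s x)" ..
      then have "y = shift ((t + 1) *s s) x"
        by (simp add: shift_shift vector_sadd_rdistrib)
      then show "\<exists>t::int. y = shift (t *s s) x" ..
    next
      assume "\<exists>t::int. y = shift (t *s s) x"
      then obtain t :: int where "y = shift (t *s s) x" ..
      moreover have "(t - 1) *s s + s = t *s s"
        by (simp add: vec_eq_iff algebra_simps)
      ultimately have "y = shift ((t - 1) *s s) (shift s x)"
        by (simp add: shift_shift)
      then show "\<exists>t::int. y = shift (t *s s) (shift s x)" ..
    qed
    then show ?thesis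
      by (simp add: r_def)
  qed
  define p where "p x \<longleftrightarrow> (\<exists>t::int. even t \<and> r x = shift (t *s s) x)" for x
  have p: "p x \<longleftrightarrow> even t" if "x \<in> free_part" "r x = shift (t *s s) x" for x t
  proof -
    have "t = u" if "t *s s = u *s s" for u :: int
    proof -
      have "(t - u) *s s = 0"
        using that by (simp add: vec_eq_iff algebra_simps)
      then have "t - u = 0 \<or> s = 0"
        by (simp only: vector_mul_eq_0)
      with assms show ?thesis
        by simp
    qed
    with that show ?thesis
      by (auto simp: p_def shift_eq_iff)
  qed
  show ?thesis
  proof (intro exI[of _ p] ballI)
    fix x :: "int ^ 'n \<Rightarrow> bool" assume x: "x \<in> free_part"
    obtain t :: int where t: "r x = shift (t *s s) x"
      using r by blast
    moreover have "(t - 1) *s s + s = t *s s"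
      by (simp add: vec_eq_iff algebra_simps)
    ultimately have "r (shift s x) = shift ((t - 1) *s s) (shift s x)"
      by (simp add: r_shift shift_shift)
    with x have "p (shift s x) \<longleftrightarrow> even (t - 1)"
      by (intro p) auto
    with p[OF x t] show "p (shift s x) \<longleftrightarrow> \<not> p x"
      by simp
  qed
qed

text \<open>The direction with index \<open>i\<close> owns the colours \<open>2 * i\<close> and
  \<open>2 * i + 1\<close>, used alternately along its lines.\<close>

lemma edge_coloring_exists:
  fixes S :: "(int ^ 'n) set"
  assumes "finite S" "uminus ` S = S" "0 \<notin> S"
  obtains c where "proper_edge_coloring (schreier_graph S) {..<card S} c"
proof -
  obtain P where P: "P \<subseteq> S" "\<And>s. s \<in> S \<Longrightarrow> s \<in> P \<or> - s \<in> P" "\<And>s. s \<in> P \<Longrightarrow> - s \<notin> P"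
    "card S = 2 * card P"
    using symmetric_half[OF assms] by blast
  have "finite P"
    using P(1) assms(1) finite_subset by blast
  then obtain idx where idx: "bij_betw idx P {0..<card P}"
    using ex_bij_betw_finite_nat by blast
  have idx_less: "idx s < card P" if "s \<in> P" for s
    using bij_betwE[OF idx] that by simp
  have idx_inj: "idx s = idx s' \<longleftrightarrow> s = s'" if "s \<in> P" "s' \<in> P" for s s'
    using bij_betw_imp_inj_on[OF idx] that by (simp add: inj_on_eq_iff)
  have "\<exists>p. \<forall>x\<in>free_part. p (shift s x) \<longleftrightarrow> \<not> p x" if "s \<in> P" for s
    by (rule line_parity) (use that P(1) assms(3) in blast)
  then have "\<forall>s\<in>P. \<exists>p. \<forall>x\<in>free_part. p (shift s x) \<longleftrightarrow> \<not> p x"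
    by blast
  from bchoice[OF this] obtain p where
    p: "\<And>s x. s \<in> P \<Longrightarrow> x \<in> free_part \<Longrightarrow> p s (shift s x) \<longleftrightarrow> \<not> p s x"
    by blast
  define f where "f s x = 2 * idx s + of_bool (p s x)" for s x
  have "\<exists>c. proper_edge_coloring (schreier_graph S) {..<card S} c \<and>
      (\<forall>s\<in>P. \<forall>x\<in>free_part. c {x, shift s x} = f s x)"
  proof (rule edge_coloring_of_directions[OF P(1-3), of f "card S"])
    show "f s x < card S" if "s \<in> P" for s x
      using idx_less[OF that] by (simp add: f_def P(4))
    show "f s (shift s x) \<noteq> f s x" if "s \<in> P" "x \<in> free_part" for s x
      using p[OF that] by (simp add: f_def)
    show "f s x \<noteq> f s' y" if "s \<in> P" "s' \<in> P" "s \<noteq> s'" for s s' x y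
    proof
      assume "f s x = f s' y"
      then have "f s x div 2 = f s' y div 2"
        by simp
      then have "idx s = idx s'"
        by (simp add: f_def)
      with idx_inj that show False
        by simp
    qed
  qed
  then show ?thesis
    using that by blast
qed

text \<open>Colour 0 is shared by all matching edges. Every other edge in direction \<open>s\<close>
  alternates between two private colours according to the parity of the distance back to the last
  point of \<open>A s\<close>. The jump of parity at a restart is harmless, because the edge there
  has colour 0.\<close>

lemma continuous_edge_coloring_exists:
  fixes S :: "(int ^ 'n) set"
  assumes "finite S" "uminus ` S = S" "0 \<notin> S"
  obtains c where "proper_edge_coloring (schreier_graph S) {..<card S + 1} c"
    "continuous_edge_coloring S {..<card S + 1} c"
proof -
  obtain P where P: "P \<subseteq> S" "\<And>s. s \<in> S \<Longrightarrow> s \<in> P \<or> - s \<in> P" "\<And>s. s \<in> P \<Longrightarrow> - s \<notin> P"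
    "card S = 2 * card P"
    using symmetric_half[OF assms] by blast
  have "finite P" "0 \<notin> P"
    using P(1) assms finite_subset by blast+
  then obtain idx where idx: "bij_betw idx P {0..<card P}"
    using ex_bij_betw_finite_nat by blast
  have idx_less: "idx s < card P" if "s \<in> P" for s
    using bij_betwE[OF idx] that by simp
  have idx_inj: "idx s = idx s' \<longleftrightarrow> s = s'" if "s \<in> P" "s' \<in> P" for s s'
    using bij_betw_imp_inj_on[OF idx] that by (simp add: inj_on_eq_iff)
  obtain A where A: "\<And>s. s \<in> P \<Longrightarrow> finitary (\<lambda>x. x \<in> A s)"
    "\<And>s x. s \<in> P \<Longrightarrow> x \<in> A s \<Longrightarrow> shift s x \<notin> A s"
    "\<And>s x. s \<in> P \<Longrightarrow> x \<in> free_part \<Longrightarrow> \<exists>t::nat. shift (- int t *s s) x \<in> A s"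
    "\<And>s s' x y. s \<in> P \<Longrightarrow> s' \<in> P \<Longrightarrow> s \<noteq> s' \<Longrightarrow> x \<in> A s \<Longrightarrow> y \<in> A s' \<Longrightarrow>
       {x, shift s x} \<inter> {y, shift s' y} = {}"
    using sparse_matching[OF \<open>finite P\<close> \<open>0 \<notin> P\<close>] by blast
  define \<tau> where "\<tau> s x = (LEAST t::nat. shift (- int t *s s) x \<in> A s)" for s x
  \<comment> \<open>The count grows by one with each step, except on reaching a point of
    \<open>A s\<close>, where it returns to 0.\<close>
  have \<tau>_shift: "\<tau> s (shift s x) = Suc (\<tau> s x)"
    if "s \<in> P" "x \<in> free_part" "shift s x \<notin> A s" for s x
  proof -
    have *: "shift (- int (Suc t) *s s) (shift s x) = shift (- int t *s s) x" for t
    proof -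
      have "- int (Suc t) *s s + s = - int t *s s"
        by (simp add: vec_eq_iff algebra_simps)
      then show ?thesis
        by (simp only: shift_shift)
    qed
    obtain t where "shift (- int t *s s) x \<in> A s"
      using A(3) \<open>s \<in> P\<close> \<open>x \<in> free_part\<close> by blast
    then have "shift (- int (Suc t) *s s) (shift s x) \<in> A s"
      by (simp only: *)
    then have "\<tau> s (shift s x) = Suc (LEAST t. shift (- int (Suc t) *s s) (shift s x) \<in> A s)"
      unfolding \<tau>_def by (rule Least_Suc) (use that(3) in simp)
    then show ?thesis
      unfolding * \<tau>_def .
  qed
  define f where "f s x = (if x \<in> A s then 0 else 1 + 2 * idx s + \<tau> s x mod 2)" for s x
  have f_less: "f s x < card S + 1" if "s \<in> P" for s x
  proof -
    have "2 * idx s + \<tau> s x mod 2 < 2 * card P"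
      using idx_less[OF that] by (auto intro: le_less_trans[of _ "2 * idx s + 1"])
    then show ?thesis
      by (simp add: f_def P(4))
  qed
  have fin_f: "finitary (f s)" if "s \<in> P" for s
  proof -
    have "finitary (\<tau> s)"
      unfolding \<tau>_def using A that by (intro finitary_Least finitary_shift[where f = "\<lambda>x. x \<in> A s"])
    then show ?thesis
      unfolding f_def using A(1)[OF that]
      by (rule finitary_compose2[where k = "\<lambda>b t. if b then 0 else 1 + 2 * idx s + t mod 2", rotated])
  qed
  have "\<exists>c. proper_edge_coloring (schreier_graph S) {..<card S + 1} c \<and>
      (\<forall>s\<in>P. \<forall>x\<in>free_part. c {x, shift s x} = f s x)"
  proof (rule edge_coloring_of_directions[OF P(1-3), of f "card S + 1"])
    show "f s x < card S + 1" if "s \<in> P" for s x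
      by (rule f_less[OF that])
    show "f s (shift s x) \<noteq> f s x" if "s \<in> P" "x \<in> free_part" for s x
    proof (cases "x \<in> A s \<or> shift s x \<in> A s")
      case True
      then show ?thesis
        using A(2)[OF that(1)] by (auto simp: f_def)
    next
      case False
      then show ?thesis
        using \<tau>_shift[OF that] by (simp add: f_def mod_Suc)
    qed
    show "f s x \<noteq> f s' y"
      if *: "s \<in> P" "s' \<in> P" "s \<noteq> s'" "{x, shift s x} \<inter> {y, shift s' y} \<noteq> {}" for s s' x y
    proof
      assume eq: "f s x = f s' y"
      show False
      proof (cases "x \<in> A s \<or> y \<in> A s'")
        case True
        with eq have "x \<in> A s" "y \<in> A s'"
          by (auto simp: f_def split: if_splits)
        with A(4) * show False
          by blast
      next
        case False
        with eq have "(2 * idx s + \<tau> s x mod 2) div 2 = (2 * idx s' + \<tau> s' y mod 2) div 2"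
          by (simp add: f_def)
        then have "idx s = idx s'"
          by simp
        with idx_inj * show False
          by simp
      qed
    qed
  qed
  then obtain c where c_proper: "proper_edge_coloring (schreier_graph S) {..<card S + 1} c"
    and c: "\<And>s x. s \<in> P \<Longrightarrow> x \<in> free_part \<Longrightarrow> c {x, shift s x} = f s x"
    by blast
  have "continuous_edge_coloring S {..<card S + 1} c"
    unfolding continuous_edge_coloring_def continuous_map_discrete_iff_finitary
  proof (intro ballI)
    fix s assume s: "s \<in> S"
    have "\<exists>g. finitary g \<and> (\<forall>x\<in>free_part. g x < card S + 1 \<and> c {x, shift s x} = g x)"
    proof (cases "s \<in> P")
      case True
      with c fin_f f_less show ?thesis
        by (intro exI[of _ "f s"]) simp
    next
      case False
      \<comment> \<open>The colour of this edge is prescribed from its other end, with direction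
        \<open>- s\<close>; a shift preserves finite windows.\<close>
      with P(2) s have "- s \<in> P"
        by blast
      have "c {x, shift s x} = f (- s) (shift s x)" if "x \<in> free_part" for x
        using c[OF \<open>- s \<in> P\<close>, of "shift s x"] that by (simp add: shift_shift insert_commute)
      with \<open>- s \<in> P\<close> f_less fin_f show ?thesis
        by (intro exI[of _ "\<lambda>x. f (- s) (shift s x)"]) (simp add: finitary_shift)
    qed
    then obtain g where "finitary g" "\<forall>x\<in>free_part. g x < card S + 1 \<and> c {x, shift s x} = g x"
      by blast
    moreover from this have "finitary (\<lambda>x. c {x, shift s x})"
      by (auto intro: finitary_depends)
    ultimately show "(\<lambda>x. c {x, shift s x}) ` free_part \<subseteq> {..<card S + 1} \<and>
        finitary (\<lambda>x. c {x, shift s x})"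
      by auto
  qed
  with c_proper show ?thesis
    by (rule that)
qed

section \<open>Uniformly aperiodic points of odd period\<close>

text \<open>Over the field \<open>bit\<close>, the ones contributed by the two members of each pair
  cancel.\<close>

lemma even_card_involution:
  assumes "\<And>x. x \<in> A \<Longrightarrow> h x \<in> A" "\<And>x. x \<in> A \<Longrightarrow> h (h x) = x" "\<And>x. x \<in> A \<Longrightarrow> h x \<noteq> x"
  shows "even (card A)"
proof -
  have "(\<Sum>x\<in>A. 1 :: bit) = 0"
    by (rule sum_involution_eq_0[where h = h]) (use assms in auto)
  then have "of_nat (card A) = (0 :: bit)"
    by simp
  then have "even (of_nat (card A) :: bit)"
    by simp
  then show ?thesis
    by (simp only: even_of_nat_iff)
qed

section \<open>Compactness and uniform windows\<close>

lemma compact_UNIV_fun_bool: "compact (UNIV :: ('a \<Rightarrow> bool) set)"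
proof -
  have "compact_space (product_topology (\<lambda>i::'a. euclidean :: bool topology) UNIV)"
    unfolding compact_space_product_topology by (simp add: compact_space_def finite_imp_compact)
  then show ?thesis
    by (simp add: euclidean_product_topology compact_space_def)
qed

lemma closed_cylinder:
  assumes "finite H"
  shows "closed {y :: 'a \<Rightarrow> bool. \<forall>h\<in>H. y h = x h}"
proof -
  have "open {y :: 'a \<Rightarrow> bool. \<forall>k\<in>{h}. y k = (\<lambda>h. \<not> x h) k}" for h
    by (rule open_cylinder) simp
  then have "open (\<Union>h\<in>H. {y :: 'a \<Rightarrow> bool. \<forall>k\<in>{h}. y k = (\<lambda>h. \<not> x h) k})"
    by blast
  also have "(\<Union>h\<in>H. {y :: 'a \<Rightarrow> bool. \<forall>k\<in>{h}. y k = (\<lambda>h. \<not> x h) k}) =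
      - {y. \<forall>h\<in>H. y h = x h}"
    by auto
  finally show ?thesis
    by (simp add: closed_def)
qed

text \<open>Finitely many cylinders on which \<open>\<sigma>\<close> is constant cover the compact
  set. Points that agree on the union of their windows lie in a common one of them.\<close>

lemma finitary_uniform:
  assumes "finitary \<sigma>" "compact X" "X \<subseteq> free_part"
  obtains H where "finite H"
    "\<forall>x\<in>X. \<forall>y\<in>X. (\<forall>h\<in>H. x h = y h) \<longrightarrow> \<sigma> x = \<sigma> y"
proof -
  have "\<forall>x\<in>X. \<exists>H. finite H \<and> (\<forall>y\<in>free_part. (\<forall>h\<in>H. y h = x h) \<longrightarrow> \<sigma> y = \<sigma> x)"
    using assms(1,3) unfolding finitary_def by blast
  from bchoice[OF this] obtain W where
    W: "\<forall>x\<in>X. finite (W x) \<and> (\<forall>y\<in>free_part. (\<forall>h\<in>W x. y h = x h) \<longrightarrow> \<sigma> y = \<sigma> x)" ..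
  obtain D where D: "D \<subseteq> X" "finite D" "X \<subseteq> (\<Union>x\<in>D. {y. \<forall>h\<in>W x. y h = x h})"
  proof (rule compactE_image[OF assms(2)])
    show "open {y. \<forall>h\<in>W x. y h = x h}" if "x \<in> X" for x
      using W that by (intro open_cylinder) blast
    show "X \<subseteq> (\<Union>x\<in>X. {y. \<forall>h\<in>W x. y h = x h})"
      by auto
  qed
  show ?thesis
  proof (rule that[of "\<Union>x\<in>D. W x"])
    show "finite (\<Union>x\<in>D. W x)"
      using D W by blast
  next
    show "\<forall>x\<in>X. \<forall>y\<in>X. (\<forall>h\<in>(\<Union>x\<in>D. W x). x h = y h) \<longrightarrow> \<sigma> x = \<sigma> y"
    proof (intro ballI impI)
      fix x y assume x: "x \<in> X" and y: "y \<in> X" and eq: "\<forall>h\<in>(\<Union>x\<in>D. W x). x h = y h"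
      obtain z where z: "z \<in> D" "\<forall>h\<in>W z. x h = z h"
        using D(3) x by blast
      have "\<forall>h\<in>W z. y h = z h"
      proof
        fix h assume "h \<in> W z"
        with z eq show "y h = z h"
          by auto
      qed
      moreover have "\<forall>y\<in>free_part. (\<forall>h\<in>W z. y h = z h) \<longrightarrow> \<sigma> y = \<sigma> z"
        using W D(1) z(1) by blast
      ultimately show "\<sigma> x = \<sigma> y"
        using z x y assms(3) by (metis subsetD)
    qed
  qed
qed

text \<open>The base 3 makes all periods odd, which is what the parity argument needs.\<close>

primrec toeplitz :: "nat \<Rightarrow> int \<Rightarrow> bool" where
  "toeplitz 0 t = False"
| "toeplitz (Suc K) t = (if 3 dvd t then toeplitz K (t div 3) else t mod 3 = 1)"

text \<open>In base 3, \<open>toeplitz K t\<close> asks whether the lowest nonzero digit among the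
  last \<open>K\<close> digits of \<open>t\<close> exists and is 1. Trailing zeros only use up
  levels.\<close>

lemma toeplitz_scale: "toeplitz (j + K) (3 ^ j * t) = toeplitz K t"
  by (induction j) (simp_all add: mult.assoc)

lemma toeplitz_periodic: "toeplitz K (t + 3 ^ K * m) = toeplitz K t"
proof (induction K arbitrary: t)
  case (Suc K)
  have eq: "t + 3 ^ Suc K * m = t + 3 * (3 ^ K * m)"
    by simp
  have "3 dvd t + 3 ^ Suc K * m \<longleftrightarrow> 3 dvd t"
    unfolding eq by presburger
  moreover have "(t + 3 ^ Suc K * m) div 3 = t div 3 + 3 ^ K * m"
    unfolding eq by simp
  moreover have "(t + 3 ^ Suc K * m) mod 3 = t mod 3"
    unfolding eq by simp
  ultimately show ?case
    by (simp add: Suc.IH del: power_Suc)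
qed simp

text \<open>Write \<open>s = 3 ^ j * u\<close> with \<open>u\<close> prime to 3. On multiples of
  \<open>3 ^ j\<close> the sequence reproduces itself at \<open>K - j\<close> levels and the shift
  becomes \<open>u\<close>; there residues modulo 9 decide. Both agreement and disagreement are
  recorded, since in higher dimension the other coordinates determine which one is useful.\<close>

lemma toeplitz_shift_nonconstant:
  assumes "s \<noteq> 0"
  shows "\<exists>(L::int) K\<^sub>0. \<forall>K\<ge>K\<^sub>0. \<forall>g.
    (\<exists>t\<in>{0..<L}. toeplitz K (g + t) \<noteq> toeplitz K (g + t + s)) \<and>
    (\<exists>t\<in>{0..<L}. toeplitz K (g + t) = toeplitz K (g + t + s))"
proof -
  define j where "j = multiplicity 3 s"
  obtain u where u: "s = 3 ^ j * u" "\<not> 3 dvd u"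
    unfolding j_def by (rule multiplicity_decompose'[of s 3]) (use assms in auto)
  define L :: int where "L = 3 ^ (j + 2)"
  \<comment> \<open>A window of length \<open>L = 3 ^ j * 9\<close> meets every residue class modulo
    \<open>L\<close>, in particular that of \<open>3 ^ j * a\<close>.\<close>
  have reach: "\<exists>t\<in>{0..<L}. \<exists>q. toeplitz K (g + t) = toeplitz (K - j) (a + 9 * q) \<and>
      toeplitz K (g + t + s) = toeplitz (K - j) (a + u + 9 * q)"
    if "j + 2 \<le> K" for K g a
  proof -
    define t where "t = (3 ^ j * a - g) mod L"
    define q where "q = - ((3 ^ j * a - g) div L)"
    have "g + t = 3 ^ j * a + L * q"
      using mult_div_mod_eq[of L "3 ^ j * a - g"] by (simp add: t_def q_def algebra_simps)
    then have "g + t = 3 ^ j * (a + 9 * q)" "g + t + s = 3 ^ j * (a + u + 9 * q)"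
      by (simp_all add: L_def u(1) power_add algebra_simps)
    moreover have "t \<in> {0..<L}"
      by (simp add: t_def L_def)
    moreover have "toeplitz K (3 ^ j * v) = toeplitz (K - j) v" for v
      using toeplitz_scale[of j "K - j" v] that by simp
    ultimately show ?thesis
      by metis
  qed
  \<comment> \<open>At least two levels remain, enough to evaluate the residue 3 modulo 9 as
    well.\<close>
  have val: "v mod 3 = 1 \<Longrightarrow> toeplitz (K - j) v" "v mod 3 = 2 \<Longrightarrow> \<not> toeplitz (K - j) v"
    "v mod 9 = 3 \<Longrightarrow> toeplitz (K - j) v" if "j + 2 \<le> K" for K v
  proof -
    have M: "K - j = Suc (Suc (K - j - 2))"
      using that by linarith
    show "v mod 3 = 1 \<Longrightarrow> toeplitz (K - j) v" "v mod 3 = 2 \<Longrightarrow> \<not> toeplitz (K - j) v"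
      by (subst M; simp add: dvd_eq_mod_eq_0)+
    assume "v mod 9 = 3"
    then have "3 dvd v" "\<not> 3 dvd v div 3" "v div 3 mod 3 = 1"
      by presburger+
    then show "toeplitz (K - j) v"
      by (subst M) simp
  qed
  show ?thesis
  proof (rule exI[of _ L], rule exI[of _ "j + 2"], intro allI impI conjI)
    fix K g assume K: "j + 2 \<le> K"
    have u3: "u mod 3 = 1 \<or> u mod 3 = 2"
      using u(2) by presburger
    \<comment> \<open>With \<open>a\<close> congruent to \<open>u\<close> modulo 3, one of
      \<open>a\<close> and \<open>a + u\<close> has last digit 1 and the other 2.\<close>
    from u3 obtain a where a: "\<And>q. toeplitz (K - j) (a + 9 * q) \<noteq> toeplitz (K - j) (a + u + 9 * q)"
    proof
      assume "u mod 3 = 1"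
      then have "(1 + 9 * q) mod 3 = 1" "(1 + u + 9 * q) mod 3 = 2" for q
        by presburger+
      with val[OF K] that[of 1] show thesis
        by simp
    next
      assume "u mod 3 = 2"
      then have "(2 + 9 * q) mod 3 = 2" "(2 + u + 9 * q) mod 3 = 1" for q
        by presburger+
      with val[OF K] that[of 2] show thesis
        by blast
    qed
    then show "\<exists>t\<in>{0..<L}. toeplitz K (g + t) \<noteq> toeplitz K (g + t + s)"
      using reach[OF K, of g a] by fastforce
    \<comment> \<open>Here both values are true: one argument is 1 modulo 3, the other is 3 modulo
      9.\<close>
    from u3 obtain b where b: "\<And>q. toeplitz (K - j) (b + 9 * q) = toeplitz (K - j) (b + u + 9 * q)"
    proof
      assume "u mod 3 = 1"
      then have "(3 + u + 9 * q) mod 3 = 1" for q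
        by presburger
      moreover have "(3 + 9 * q) mod 9 = 3" for q :: int
        by simp
      ultimately show thesis
        using val[OF K] that[of 3] by blast
    next
      assume "u mod 3 = 2"
      then have "(3 - u + 9 * q) mod 3 = 1" for q
        by presburger
      moreover have "(3 - u + u + 9 * q) mod 9 = 3" for q :: int
        by simp
      ultimately show thesis
        using val[OF K] that[of "3 - u"] by blast
    qed
    then show "\<exists>t\<in>{0..<L}. toeplitz K (g + t) = toeplitz K (g + t + s)"
      using reach[OF K, of g b] by fastforce
  qed
qed

text \<open>Combining the coordinates by parity makes the restriction to any line parallel to an
  axis the one-dimensional sequence or its negation, so no coordinate can mask another.\<close>

definition toeplitz_point :: "nat \<Rightarrow> int ^ 'n \<Rightarrow> bool" where
  "toeplitz_point K h \<longleftrightarrow> even (card {i. toeplitz K (h $ i)})"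

lemma toeplitz_point_periodic: "toeplitz_point K (h + 3 ^ K *s m) = toeplitz_point K h"
  by (simp add: toeplitz_point_def toeplitz_periodic)

lemma toeplitz_point_split:
  "toeplitz_point K h \<longleftrightarrow> (even (card {j. j \<noteq> i \<and> toeplitz K (h $ j)}) \<longleftrightarrow> \<not> toeplitz K (h $ i))"
proof -
  have "{j. toeplitz K (h $ j)} =
      (if toeplitz K (h $ i) then insert i {j. j \<noteq> i \<and> toeplitz K (h $ j)}
       else {j. j \<noteq> i \<and> toeplitz K (h $ j)})"
    by auto
  then show ?thesis
    unfolding toeplitz_point_def by simp
qed

text \<open>Move along an axis \<open>i\<close> on which \<open>s\<close> is nonzero. The other
  coordinates contribute fixed parities \<open>E\<close> and \<open>E'\<close>. If these are equal,
  a place where the sequence and its shift by \<open>s $ i\<close> disagree separates the two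
  points; otherwise a place where they agree does.\<close>

lemma toeplitz_point_aperiodic:
  fixes s :: "int ^ 'n"
  assumes "s \<noteq> 0"
  shows "\<exists>T. finite T \<and>
    (\<exists>K\<^sub>0. \<forall>K\<ge>K\<^sub>0. \<forall>g. \<exists>v\<in>T. toeplitz_point K (g + v) \<noteq> toeplitz_point K (g + v + s))"
proof -
  obtain i where "s $ i \<noteq> 0"
    using assms by (auto simp: vec_eq_iff)
  from toeplitz_shift_nonconstant[OF this] obtain L :: int and K\<^sub>0 where LK:
    "\<forall>K\<ge>K\<^sub>0. \<forall>g. (\<exists>t\<in>{0..<L}. toeplitz K (g + t) \<noteq> toeplitz K (g + t + s $ i)) \<and>
      (\<exists>t\<in>{0..<L}. toeplitz K (g + t) = toeplitz K (g + t + s $ i))"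
    by (elim exE)
  show ?thesis
  proof (intro exI conjI allI impI)
    show "finite ((\<lambda>t. axis i t) ` {0..<L})"
      by simp
    fix K g assume K: "K\<^sub>0 \<le> K"
    define E E' where "E \<longleftrightarrow> even (card {j. j \<noteq> i \<and> toeplitz K (g $ j)})"
      and "E' \<longleftrightarrow> even (card {j. j \<noteq> i \<and> toeplitz K (g $ j + s $ j)})"
    have eq: "toeplitz_point K (g + axis i t) \<longleftrightarrow> (E \<longleftrightarrow> \<not> toeplitz K (g $ i + t))"
      "toeplitz_point K (g + axis i t + s) \<longleftrightarrow> (E' \<longleftrightarrow> \<not> toeplitz K (g $ i + t + s $ i))" for t
    proof -
      have "{j. j \<noteq> i \<and> toeplitz K ((g + axis i t) $ j)} = {j. j \<noteq> i \<and> toeplitz K (g $ j)}"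
        "{j. j \<noteq> i \<and> toeplitz K ((g + axis i t + s) $ j)} = {j. j \<noteq> i \<and> toeplitz K (g $ j + s $ j)}"
        by (auto simp: axis_def)
      then show "toeplitz_point K (g + axis i t) \<longleftrightarrow> (E \<longleftrightarrow> \<not> toeplitz K (g $ i + t))"
        "toeplitz_point K (g + axis i t + s) \<longleftrightarrow> (E' \<longleftrightarrow> \<not> toeplitz K (g $ i + t + s $ i))"
        unfolding toeplitz_point_split[of _ _ i] E_def E'_def by (simp_all add: axis_def)
    qed
    obtain t u where "t \<in> {0..<L}" "toeplitz K (g $ i + t) \<noteq> toeplitz K (g $ i + t + s $ i)"
      "u \<in> {0..<L}" "toeplitz K (g $ i + u) = toeplitz K (g $ i + u + s $ i)"
      using LK[rule_format, OF K, of "g $ i"] by blast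
    then show "\<exists>v\<in>(\<lambda>t. axis i t) ` {0..<L}. toeplitz_point K (g + v) \<noteq> toeplitz_point K (g + v + s)"
      using eq[of t] eq[of u] by (cases "E = E'") blast+
  qed
qed

text \<open>\<open>X\<close> consists of all points obeying the aperiodicity bound \<open>T\<close>
  for every nonzero \<open>s\<close> at every position; these conditions are closed, shift invariant
  and force freeness. The periodic points violate some of them, but satisfy any finitely many once
  \<open>K\<close> is large, so by compactness their patterns on a finite set occur in
  \<open>X\<close>.\<close>

lemma hyperaperiodic_set:
  obtains X :: "(int ^ 'n \<Rightarrow> bool) set"
  where "compact X" "X \<subseteq> free_part" "\<And>g x. x \<in> X \<Longrightarrow> shift g x \<in> X"
    and "\<And>H. finite H \<Longrightarrow> \<exists>K\<^sub>0. \<forall>K\<ge>K\<^sub>0. \<forall>g. \<exists>x\<in>X. \<forall>h\<in>H. x h = shift g (toeplitz_point K) h"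
proof -
  have "\<forall>s\<in>- {0 :: int ^ 'n}. \<exists>T. finite T \<and>
      (\<exists>K\<^sub>0. \<forall>K\<ge>K\<^sub>0. \<forall>g. \<exists>v\<in>T. toeplitz_point K (g + v) \<noteq> toeplitz_point K (g + v + s))"
    by (intro ballI toeplitz_point_aperiodic) simp
  from bchoice[OF this] obtain T where T: "\<forall>s\<in>- {0 :: int ^ 'n}. finite (T s) \<and>
      (\<exists>K\<^sub>0. \<forall>K\<ge>K\<^sub>0. \<forall>g. \<exists>v\<in>T s. toeplitz_point K (g + v) \<noteq> toeplitz_point K (g + v + s))" ..
  then have fin_T: "\<forall>s\<in>- {0 :: int ^ 'n}. finite (T s)"
    and k_ex: "\<forall>s\<in>- {0 :: int ^ 'n}.
      \<exists>K\<^sub>0. \<forall>K\<ge>K\<^sub>0. \<forall>g. \<exists>v\<in>T s. toeplitz_point K (g + v) \<noteq> toeplitz_point K (g + v + s)"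
    by simp_all
  from bchoice[OF k_ex] obtain k where k: "\<forall>s\<in>- {0 :: int ^ 'n}.
      \<forall>K\<ge>k s. \<forall>g. \<exists>v\<in>T s. toeplitz_point K (g + v) \<noteq> toeplitz_point K (g + v + s)" ..
  define N where "N p = {y :: int ^ 'n \<Rightarrow> bool. \<exists>v\<in>T (fst p). y (snd p + v) \<noteq> y (snd p + v + fst p)}"
    for p :: "(int ^ 'n) \<times> (int ^ 'n)"
  define I where "I = {p :: (int ^ 'n) \<times> (int ^ 'n). fst p \<noteq> 0}"
  define X where "X = (\<Inter>p\<in>I. N p)"
  have closed_N: "closed (N p)" if "p \<in> I" for p
  proof -
    have "closed {y :: int ^ 'n \<Rightarrow> bool. y a \<noteq> y b}" for a b
    proof (cases "a = b")
      case False
      then have "{y :: int ^ 'n \<Rightarrow> bool. y a \<noteq> y b} =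
          {y. \<forall>h\<in>{a, b}. y h = (h = a)} \<union> {y. \<forall>h\<in>{a, b}. y h = (h = b)}"
        by auto
      moreover have "closed {y. \<forall>h\<in>{a, b}. y h = (h = c)}" for c
        by (rule closed_cylinder) simp
      ultimately show ?thesis
        by (simp only: closed_Un)
    qed simp
    moreover have "finite (T (fst p))"
    proof -
      have "fst p \<in> - {0}"
        using that by (simp add: I_def)
      with fin_T show ?thesis ..
    qed
    moreover have "N p = (\<Union>v\<in>T (fst p). {y. y (snd p + v) \<noteq> y (snd p + v + fst p)})"
      by (auto simp: N_def)
    ultimately show ?thesis
      by (auto intro: closed_UN)
  qed
  show ?thesis
  proof (rule that[of X])
    have "closed X"
      unfolding X_def by (intro closed_INT ballI closed_N)
    then show "compact X"
      using compact_Int_closed[OF compact_UNIV_fun_bool] by fastforce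
    show "X \<subseteq> free_part"
    proof
      fix x assume x: "x \<in> X"
      have "shift s x \<noteq> x" if "s \<noteq> 0" for s
      proof
        assume eq: "shift s x = x"
        have "x \<in> N (s, 0)"
          using x that by (auto simp: X_def I_def)
        then obtain v where "x v \<noteq> x (v + s)"
          by (auto simp: N_def)
        with fun_cong[OF eq, of v] show False
          by (simp add: shift_def)
      qed
      then show "x \<in> free_part"
        by (simp add: free_part_def)
    qed
    show "shift g x \<in> X" if "x \<in> X" for g x
      unfolding X_def
    proof
      fix p assume "p \<in> I"
      then have "(fst p, snd p + g) \<in> I"
        by (simp add: I_def)
      with that have "x \<in> N (fst p, snd p + g)"
        unfolding X_def by blast
      then show "shift g x \<in> N p"
        by (simp add: N_def shift_def add_ac)
    qed
  next
    fix H :: "(int ^ 'n) set" assume H: "finite H"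
    define C where "C Q = {y. \<forall>h\<in>H. y h = (h \<in> Q)}" for Q
    \<comment> \<open>The subsets \<open>Q\<close> of \<open>H\<close> index the patterns on
      \<open>H\<close>. A pattern absent from \<open>X\<close> is excluded by finitely many
      conditions \<open>J\<close>. Sums of thresholds serve as common upper bounds, first over
      \<open>J\<close> and later over all patterns.\<close>
    have "\<exists>K\<^sub>0. \<forall>K\<ge>K\<^sub>0. \<forall>g. shift g (toeplitz_point K) \<notin> C Q" if "C Q \<inter> X = {}" for Q
    proof -
      have "compact (C Q)"
        using compact_Int_closed[OF compact_UNIV_fun_bool closed_cylinder[OF H]]
        by (simp add: C_def)
      then obtain J where J: "finite J" "J \<subseteq> I" "C Q \<inter> (\<Inter>p\<in>J. N p) = {}"
        using compact_imp_fip_image[of "C Q" I N] closed_N \<open>C Q \<inter> X = {}\<close> unfolding X_def by blast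
      have "shift g (toeplitz_point K) \<notin> C Q" if "(\<Sum>p\<in>J. k (fst p)) \<le> K" for K g
      proof -
        have "shift g (toeplitz_point K) \<in> N p" if p: "p \<in> J" for p
        proof -
          have "k (fst p) \<le> K"
            using member_le_sum[OF p, of "\<lambda>p. k (fst p)"] J(1) \<open>(\<Sum>p\<in>J. k (fst p)) \<le> K\<close> by simp
          moreover have "fst p \<noteq> 0"
            using J(2) p by (auto simp: I_def)
          ultimately have "\<exists>v\<in>T (fst p). toeplitz_point K ((snd p + g) + v) \<noteq>
              toeplitz_point K ((snd p + g) + v + fst p)"
            by (intro k[rule_format]) simp_all
          then show ?thesis
            by (simp add: N_def shift_def add_ac)
        qed
        with J(3) show ?thesis
          by blast
      qed
      then show ?thesis
        by blast
    qed
    then have "\<forall>Q. \<exists>K\<^sub>0. C Q \<inter> X = {} \<longrightarrow> (\<forall>K\<ge>K\<^sub>0. \<forall>g. shift g (toeplitz_point K) \<notin> C Q)"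
      by blast
    from choice[OF this] obtain l where
      l: "\<forall>Q. C Q \<inter> X = {} \<longrightarrow> (\<forall>K\<ge>l Q. \<forall>g. shift g (toeplitz_point K) \<notin> C Q)" ..
    have "\<exists>x\<in>X. \<forall>h\<in>H. x h = shift g (toeplitz_point K) h" if K: "(\<Sum>Q\<in>Pow H. l Q) \<le> K" for K g
    proof -
      define Q where "Q = {h \<in> H. shift g (toeplitz_point K) h}"
      have "l Q \<le> K"
        using member_le_sum[of Q "Pow H" l] H K by (simp add: Q_def)
      moreover have "shift g (toeplitz_point K) \<in> C Q"
        by (simp add: C_def Q_def)
      ultimately have "C Q \<inter> X \<noteq> {}"
        using l by blast
      then obtain x where "x \<in> X" "x \<in> C Q"
        by blast
      then show ?thesis
        by (auto simp: C_def Q_def)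
    qed
    then show "\<exists>K\<^sub>0. \<forall>K\<ge>K\<^sub>0. \<forall>g. \<exists>x\<in>X. \<forall>h\<in>H. x h = shift g (toeplitz_point K) h"
      by blast
  qed
qed

lemma card_box:
  "finite {h :: int ^ 'n. \<forall>i. h $ i \<in> {0..<p}}"
  "card {h :: int ^ 'n. \<forall>i. h $ i \<in> {0..<p}} = nat p ^ CARD('n)"
proof -
  have eq: "{h :: int ^ 'n. \<forall>i. h $ i \<in> {0..<p}} = vec_lambda ` (PiE UNIV (\<lambda>_. {0..<p}))"
  proof
    show "{h :: int ^ 'n. \<forall>i. h $ i \<in> {0..<p}} \<subseteq> vec_lambda ` (PiE UNIV (\<lambda>_. {0..<p}))"
    proof
      fix h :: "int ^ 'n" assume "h \<in> {h. \<forall>i. h $ i \<in> {0..<p}}"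
      then show "h \<in> vec_lambda ` (PiE UNIV (\<lambda>_. {0..<p}))"
        by (intro image_eqI[of _ _ "vec_nth h"]) auto
    qed
  qed auto
  have "finite (PiE (UNIV :: 'n set) (\<lambda>_. {0..<p}))"
    by (intro finite_PiE) auto
  then show "finite {h :: int ^ 'n. \<forall>i. h $ i \<in> {0..<p}}"
    unfolding eq by (rule finite_imageI)
  have "card {h :: int ^ 'n. \<forall>i. h $ i \<in> {0..<p}} = card (PiE (UNIV :: 'n set) (\<lambda>_. {0..<p}))"
    unfolding eq by (rule card_image) (simp add: inj_on_def vec_lambda_inject)
  then show "card {h :: int ^ 'n. \<forall>i. h $ i \<in> {0..<p}} = nat p ^ CARD('n)"
    by (simp add: card_PiE)
qed

section \<open>Lower bounds\<close>

text \<open>\<open>\<sigma> x\<close> is the step from \<open>x\<close> to its partner. On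
  \<open>X\<close> it is given by one window, whose patterns for large \<open>K\<close> include all
  those of the periodic point, so \<open>\<sigma>\<close> transfers to a torus of side
  \<open>3 ^ K\<close>. There it would be a fixed-point free involution on an odd number of
  vertices.\<close>

lemma no_finitary_perfect_matching:
  fixes S :: "(int ^ 'n) set"
  assumes "finite S" "0 \<notin> S" "finitary \<sigma>"
    and \<sigma>: "\<And>x. x \<in> free_part \<Longrightarrow> \<sigma> x \<in> S \<and> \<sigma> (shift (\<sigma> x) x) = - \<sigma> x"
  shows False
proof -
  obtain X :: "(int ^ 'n \<Rightarrow> bool) set" where X: "compact X" "X \<subseteq> free_part"
      "\<And>g x. x \<in> X \<Longrightarrow> shift g x \<in> X"
    and dense: "\<And>H. finite H \<Longrightarrow>
      \<exists>K\<^sub>0. \<forall>K\<ge>K\<^sub>0. \<forall>g. \<exists>x\<in>X. \<forall>h\<in>H. x h = shift g (toeplitz_point K) h"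
    by (rule hyperaperiodic_set) (rule that)
  obtain H where H: "finite H"
    "\<forall>x\<in>X. \<forall>y\<in>X. (\<forall>h\<in>H. x h = y h) \<longrightarrow> \<sigma> x = \<sigma> y"
    by (rule finitary_uniform[OF assms(3) X(1,2)])
  \<comment> \<open>The translates let one representative see the window of a vertex and the window
    of its partner.\<close>
  define H' where "H' = H \<union> (\<Union>s\<in>S. (\<lambda>h. h + s) ` H)"
  have "finite H'"
    using H(1) assms(1) by (simp add: H'_def)
  then obtain K\<^sub>0 where K\<^sub>0:
    "\<forall>K\<ge>K\<^sub>0. \<forall>g. \<exists>x\<in>X. \<forall>h\<in>H'. x h = shift g (toeplitz_point K) h"
    using dense by blast
  define b where "b = (\<Sum>s\<in>S. \<Sum>i\<in>UNIV. nat \<bar>s $ i\<bar>)"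
  \<comment> \<open>\<open>K\<^sub>0\<close> guarantees representatives in \<open>X\<close>;
    \<open>b\<close> makes the side of the torus exceed every coordinate of a generator.\<close>
  define K where "K = K\<^sub>0 + b"
  define p :: int where "p = 3 ^ K"
  have small: "\<bar>s $ i\<bar> < p" if "s \<in> S" for s i
  proof -
    have "nat \<bar>s $ i\<bar> \<le> (\<Sum>i\<in>UNIV. nat \<bar>s $ i\<bar>)"
      by (rule member_le_sum) auto
    also have "\<dots> \<le> b"
      unfolding b_def using that assms(1) by (intro member_le_sum[of s S "\<lambda>s. \<Sum>i\<in>UNIV. nat \<bar>s $ i\<bar>"]) auto
    also have "\<dots> \<le> K"
      by (simp add: K_def)
    finally have "\<bar>s $ i\<bar> \<le> int K"
      by simp
    also have "int K < int (3 ^ K)"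
      by (simp only: of_nat_less_iff) (rule power_gt_expt, simp)
    finally show ?thesis
      by (simp add: p_def)
  qed
  define near where "near g x \<longleftrightarrow> x \<in> X \<and> (\<forall>h\<in>H'. x h = shift g (toeplitz_point K) h)" for g x
  \<comment> \<open>All representatives near \<open>g\<close> agree on \<open>H\<close>, so the
    choice does not affect \<open>d g\<close>.\<close>
  define d where "d g = \<sigma> (SOME x. near g x)" for g
  have d: "d g = \<sigma> x" if "near g x" for g x
  proof -
    have "near g (SOME x. near g x)"
      using that by (rule someI[of "near g"])
    with that have "\<sigma> (SOME x. near g x) = \<sigma> x"
      by (intro H(2)[rule_format]) (auto simp: near_def H'_def)
    then show ?thesis
      by (simp add: d_def)
  qed
  have near_ex: "\<exists>x. near g x" for g
    using K\<^sub>0[rule_format, of K g] by (auto simp: near_def K_def)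
  have d_S: "d g \<in> S" and d_inv: "d (g + d g) = - d g" for g
  proof -
    obtain x where x: "near g x"
      using near_ex by blast
    then have "x \<in> X" "x \<in> free_part"
      using X(2) by (auto simp: near_def)
    then have \<sigma>_x: "\<sigma> x \<in> S" "\<sigma> (shift (\<sigma> x) x) = - \<sigma> x"
      using \<sigma> by blast+
    then show "d g \<in> S"
      using d[OF x] by simp
    obtain y where y: "near (g + d g) y"
      using near_ex by blast
    \<comment> \<open>The partner has its own representative \<open>y\<close>. On \<open>H\<close>
      it agrees with the shifted \<open>x\<close>, since both copy the same part of the periodic
      point; hence \<open>\<sigma>\<close> cannot tell them apart.\<close>
    have "y h = shift (\<sigma> x) x h" if "h \<in> H" for h
    proof -
      have "y h = toeplitz_point K (h + (g + \<sigma> x))"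
        using y that d[OF x] by (simp add: near_def H'_def shift_def)
      also have "h + (g + \<sigma> x) = (h + \<sigma> x) + g"
        by (simp add: add_ac)
      also have "toeplitz_point K \<dots> = x (h + \<sigma> x)"
      proof -
        have "h + \<sigma> x \<in> H'"
          using that \<sigma>_x(1) by (auto simp: H'_def)
        with x show ?thesis
          by (simp add: near_def shift_def)
      qed
      finally show ?thesis
        by (simp add: shift_def)
    qed
    moreover have "y \<in> X" "shift (\<sigma> x) x \<in> X"
      using y X(3) \<open>x \<in> X\<close> by (auto simp: near_def)
    ultimately have "\<sigma> y = \<sigma> (shift (\<sigma> x) x)"
      by (intro H(2)[rule_format]) simp_all
    with \<sigma>_x show "d (g + d g) = - d g"
      using d[OF x] d[OF y] by simp
  qed
  define red where "red g = (\<chi> i. g $ i mod p)" for g :: "int ^ 'n"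
  have d_red: "d (red g) = d g" for g
  proof -
    have "red g = g + 3 ^ K *s (\<chi> i. - (g $ i div p))"
      by (simp add: vec_eq_iff red_def p_def minus_mult_div_eq_mod flip: minus_mult_div_eq_mod)
    then have "shift (red g) (toeplitz_point K) = shift g (toeplitz_point K)"
      by (simp add: shift_def fun_eq_iff toeplitz_point_periodic flip: add.assoc)
    then show ?thesis
      by (simp add: d_def near_def)
  qed
  define B where "B = {h :: int ^ 'n. \<forall>i. h $ i \<in> {0..<p}}"
  have "p > 0"
    by (simp add: p_def)
  have "even (card B)"
  proof (rule even_card_involution[where h = "\<lambda>g. red (g + d g)"])
    fix g assume g: "g \<in> B"
    then have g_mod: "g $ i mod p = g $ i" for i
      by (simp add: B_def)
    show "red (g + d g) \<in> B"
      using \<open>p > 0\<close> by (simp add: B_def red_def)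
    have "d (red (g + d g)) = - d g"
      by (simp add: d_red d_inv)
    then show "red (red (g + d g) + d (red (g + d g))) = g"
      by (simp add: red_def vec_eq_iff mod_diff_left_eq g_mod)
    \<comment> \<open>A generator vanishing modulo \<open>p\<close> would be 0, because its
      coordinates are smaller than \<open>p\<close> in absolute value.\<close>
    show "red (g + d g) \<noteq> g"
    proof
      assume eq: "red (g + d g) = g"
      have "d g $ i = 0" for i
      proof -
        have "(g $ i + d g $ i) mod p = g $ i mod p"
          using arg_cong[OF eq, of "\<lambda>v. v $ i"] by (simp add: red_def g_mod)
        then have "p dvd d g $ i"
          by (simp add: mod_eq_dvd_iff)
        show ?thesis
        proof (rule ccontr)
          assume "d g $ i \<noteq> 0"
          then have "\<bar>p\<bar> \<le> \<bar>d g $ i\<bar>"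
            using \<open>p dvd d g $ i\<close> by (rule dvd_imp_le_int)
          with small[OF d_S[of g], of i] show False
            by linarith
        qed
      qed
      then have "d g = 0"
        by (simp add: vec_eq_iff)
      with d_S[of g] assms(2) show False
        by simp
    qed
  qed
  moreover have "card B = nat p ^ CARD('n)"
    unfolding B_def by (rule card_box)
  moreover have "nat p = 3 ^ K"
    by (simp add: p_def nat_power_eq)
  ultimately show False
    by simp
qed

section \<open>Counting the colours at a vertex\<close>

lemma inj_on_edge_colors:
  fixes S :: "(int ^ 'n) set"
  assumes c: "proper_edge_coloring (schreier_graph S) C c" and "0 \<notin> S" and x: "x \<in> free_part"
  shows "inj_on (\<lambda>s. c {x, shift s x}) S" "(\<lambda>s. c {x, shift s x}) ` S \<subseteq> C"
proof -
  have edge: "{x, shift s x} \<in> snd (schreier_graph S)" if "s \<in> S" for s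
  proof -
    have "x \<noteq> shift s x"
      using that assms(2) shift_eq_self_iff[OF x, of s] by auto
    with that x show ?thesis
      unfolding schreier_graph_def snd_conv
      by (intro CollectI exI[of _ x] exI[of _ "shift s x"]) auto
  qed
  show "inj_on (\<lambda>s. c {x, shift s x}) S"
  proof (rule inj_onI, rule ccontr)
    fix s t assume st: "s \<in> S" "t \<in> S" "c {x, shift s x} = c {x, shift t x}" "s \<noteq> t"
    then have "shift s x \<noteq> shift t x"
      using x by (simp add: shift_eq_iff)
    then have "{x, shift s x} \<noteq> {x, shift t x}"
      by (auto simp: doubleton_eq_iff)
    moreover have "\<forall>e\<in>snd (schreier_graph S). \<forall>f\<in>snd (schreier_graph S).
        e \<noteq> f \<and> e \<inter> f \<noteq> {} \<longrightarrow> c e \<noteq> c f"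
      using c by (simp add: proper_edge_coloring_def)
    ultimately have "c {x, shift s x} \<noteq> c {x, shift t x}"
      using edge[OF st(1)] edge[OF st(2)] by (metis disjoint_iff insertI1)
    with st(3) show False
      by simp
  qed
  show "(\<lambda>s. c {x, shift s x}) ` S \<subseteq> C"
    using c edge by (auto simp: proper_edge_coloring_def)
qed

lemma card_le_edge_coloring:
  assumes "proper_edge_coloring (schreier_graph S) {..<k} c" "0 \<notin> S"
  shows "card S \<le> k"
  using card_inj_on_le[OF inj_on_edge_colors[OF assms free_part_nonempty]] by simp

text \<open>With only \<open>card S\<close> colours, every colour occurs exactly once at each free
  point. The edges of colour 0 then form a perfect matching, and \<open>\<sigma> x\<close> is the
  direction of the one at \<open>x\<close>; continuity of the colouring makes
  \<open>\<sigma>\<close> finitary.\<close>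

lemma card_less_continuous_edge_coloring:
  fixes S :: "(int ^ 'n) set"
  assumes S: "finite S" "uminus ` S = S" "0 \<notin> S" "S \<noteq> {}"
    and c: "proper_edge_coloring (schreier_graph S) {..<k} c" "continuous_edge_coloring S {..<k} c"
  shows "card S < k"
proof (rule ccontr)
  assume "\<not> card S < k"
  with card_le_edge_coloring[OF c(1) S(3)] have k: "k = card S"
    by simp
  have inj: "inj_on (\<lambda>s. c {x, shift s x}) S" if "x \<in> free_part" for x
    by (rule inj_on_edge_colors[OF c(1) S(3) that])
  have "\<exists>s\<in>S. c {x, shift s x} = 0" if x: "x \<in> free_part" for x
  proof -
    have "card ((\<lambda>s. c {x, shift s x}) ` S) = card {..<k}"
      using card_image[OF inj[OF x]] by (simp add: k)
    then have "(\<lambda>s. c {x, shift s x}) ` S = {..<k}"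
      using inj_on_edge_colors(2)[OF c(1) S(3) x] by (intro card_subset_eq) auto
    moreover have "0 < k"
      using S(1,4) by (simp add: k card_gt_0_iff)
    ultimately have "0 \<in> (\<lambda>s. c {x, shift s x}) ` S"
      by simp
    then obtain s where "0 = c {x, shift s x}" "s \<in> S"
      by (rule imageE)
    then show ?thesis
      by (intro bexI[of _ s]) simp_all
  qed
  then have "\<forall>x\<in>free_part. \<exists>s. s \<in> S \<and> c {x, shift s x} = 0"
    by blast
  from bchoice[OF this] obtain \<sigma> where \<sigma>: "\<And>x. x \<in> free_part \<Longrightarrow> \<sigma> x \<in> S \<and> c {x, shift (\<sigma> x) x} = 0"
    by blast
  have \<sigma>_eq: "\<sigma> x = s" if "x \<in> free_part" "s \<in> S" "c {x, shift s x} = 0" for x s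
    using inj_onD[OF inj[OF that(1)], of "\<sigma> x" s] \<sigma>[OF that(1)] that by simp
  have fin_c: "finitary (\<lambda>x. c {x, shift s x})" if "s \<in> S" for s
    using c(2) that by (simp add: continuous_edge_coloring_def continuous_map_discrete_iff_finitary)
  have "finitary \<sigma>"
    unfolding finitary_def
  proof
    fix x :: "int ^ 'n \<Rightarrow> bool" assume x: "x \<in> free_part"
    \<comment> \<open>The window for the single direction \<open>\<sigma> x\<close> is enough: once
      that edge at \<open>y\<close> also has colour 0, uniqueness gives
      \<open>\<sigma> y = \<sigma> x\<close>.\<close>
    obtain H where H: "finite H" "\<forall>y\<in>free_part. (\<forall>h\<in>H. y h = x h) \<longrightarrow>
        c {y, shift (\<sigma> x) y} = c {x, shift (\<sigma> x) x}"
      by (rule finitaryE[OF fin_c x]) (use \<sigma>[OF x] in auto)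
    have "\<sigma> y = \<sigma> x" if "y \<in> free_part" "\<forall>h\<in>H. y h = x h" for y
      using H(2) that \<sigma>[OF x] by (intro \<sigma>_eq) auto
    with H(1) show "\<exists>H. finite H \<and> (\<forall>y\<in>free_part. (\<forall>h\<in>H. y h = x h) \<longrightarrow> \<sigma> y = \<sigma> x)"
      by blast
  qed
  moreover have "\<sigma> (shift (\<sigma> x) x) = - \<sigma> x" if x: "x \<in> free_part" for x
  proof (rule \<sigma>_eq)
    show "- \<sigma> x \<in> S"
      using S(2) \<sigma>[OF x] by blast
    show "c {shift (\<sigma> x) x, shift (- \<sigma> x) (shift (\<sigma> x) x)} = 0"
      using \<sigma>[OF x] by (simp add: shift_shift insert_commute)
  qed (use x in simp)
  ultimately show False
    using no_finitary_perfect_matching[OF S(1,3)] \<sigma> by blast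
qed

section \<open>The two chromatic numbers\<close>

lemma INF_enat_eq:
  assumes "m \<in> A" "\<And>k. k \<in> A \<Longrightarrow> m \<le> k"
  shows "(INF k\<in>A. enat k) = enat m"
  by (rule antisym) (use assms in \<open>auto intro: INF_lower INF_greatest\<close>)

theorem theorem1p1:
  fixes S :: "(int ^ 'n) set"
  assumes "finite S"
    and "uminus ` S = S"
    and "group_closure S = UNIV"
    and "0 \<notin> S"
  shows "continuous_edge_chromatic_number S = edge_chromatic_number (schreier_graph S) + 1 \<and>
         edge_chromatic_number (schreier_graph S) + 1 = enat (card S) + 1"
proof -
  \<comment> \<open>The dimension is positive because the index type is nonempty, so the empty set
    does not generate the group.\<close>
  have "S \<noteq> {}"
  proof
    assume "S = {}"
    then have "(UNIV :: (int ^ 'n) set) = {0}"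
      using assms(3) by simp
    then have "(1 :: int ^ 'n) = 0"
      by blast
    then show False
      by (simp add: vec_eq_iff)
  qed
  have "edge_chromatic_number (schreier_graph S) = enat (card S)"
    unfolding edge_chromatic_number_def
  proof (rule INF_enat_eq)
    show "card S \<in> {k. \<exists>c. proper_edge_coloring (schreier_graph S) {..<k} c}"
      using edge_coloring_exists[OF assms(1,2,4)] by blast
    show "card S \<le> k" if "k \<in> {k. \<exists>c. proper_edge_coloring (schreier_graph S) {..<k} c}" for k
      using card_le_edge_coloring assms(4) that by blast
  qed
  moreover have "continuous_edge_chromatic_number S = enat (card S + 1)"
    unfolding continuous_edge_chromatic_number_def
  proof (rule INF_enat_eq)
    show "card S + 1 \<in> {k. \<exists>c. proper_edge_coloring (schreier_graph S) {..<k} c \<and>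
        continuous_edge_coloring S {..<k} c}"
      using continuous_edge_coloring_exists[OF assms(1,2,4)] by blast
    show "card S + 1 \<le> k" if "k \<in> {k. \<exists>c. proper_edge_coloring (schreier_graph S) {..<k} c \<and>
        continuous_edge_coloring S {..<k} c}" for k
      using card_less_continuous_edge_coloring[OF assms(1,2,4) \<open>S \<noteq> {}\<close>] that by (auto simp: Suc_le_eq)
  qed
  ultimately show ?thesis
    by (simp add: one_enat_def)
qed

end
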